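(* Let $F$ be a field and let $(H,m,u,\Delta,\varepsilon,S)$ and $(H^\vee,m^\vee,u^\vee,\Delta^\vee,\varepsilon^\vee,S^\vee)$ be graded connected Hopf algebras over $F$ with finite-dimensional graded pieces, equipped with a graded nondegenerate Hopf pairing $\langle\cdot,\cdot\rangle:H\times H^\vee\to F$. Let $(f_\lambda)_{\lambda\in\mathcal I}$ and $(g_\lambda)_{\lambda\in\mathcal I}$ be any homogeneous dual bases of $H$ and $H^\vee$, i.e. $\langle f_\lambda,g_\mu\rangle=\delta_{\lambda\mu}$, and let $\mathcal E=\sum_{\lambda\in\mathcal I}f_\lambda\otimes g_\lambda\in\widehat{H\otimes H^\vee}$. (1) For all $\lambda,\mu\in\mathcal I$, in $\widehat{H\otimes H^\vee}$, $$\mathcal E\cdot\sum_{\tau\in\mathcal I}f_{\lambda/\tau}\otimes g_{\mu/\tau}=\sum_{\rho\in\mathcal I}f_{\rho/\mu}\otimes g_{\rho/\lambda}.$$ (2) If moreover $H^\vee$ is commutative, then for all $\lambda,\eta\in\mathcal I$, in $\widehat{H\otimes H^\vee}$, $$\mathcal E\cdot\bigl(f_{\lambda/\eta}\otimes 1_{H^\vee}\bigr)=\sum_{\rho,\mu\in\mathcal I}f_{\rho/\mu}\otimes S^\vee(g_{\eta/\mu})\,g_{\rho/\lambda}.$$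
   Context: A graded connected Hopf algebra is $H=\bigoplus_{n\ge0}H_n$ with $H_0=F\cdot1$ and graded structure maps. A graded nondegenerate Hopf pairing is a bilinear form with $\langle H_i,H_j^\vee\rangle=0$ for $i\ne j$, nondegenerate on each $H_n\times H_n^\vee$, and $$\langle ab,c\rangle=\langle a\otimes b,\Delta^\vee(c)\rangle\ (a,b\in H,\ c\in H^\vee),\qquad \langle a,bc\rangle=\langle\Delta(a),b\otimes c\rangle\ (a\in H,\ b,c\in H^\vee),$$ where $\langle a\otimes b,c\otimes d\rangle=\langle a,c\rangle\langle b,d\rangle$. Dual bases are homogeneous with $\deg f_\lambda=\deg g_\lambda$. Skew elements $f_{\lambda/\mu}\in H$ and $g_{\lambda/\mu}\in H^\vee$ are defined by $$\Delta(f_\lambda)=\sum_{\mu\in\mathcal I}f_{\lambda/\mu}\otimes f_\mu,\qquad\Delta^\vee(g_\lambda)=\sum_{\mu\in\mathcal I}g_{\lambda/\mu}\otimes g_\mu.$$ $\widehat{H\otimes H^\vee}=\prod_{n\ge0}(H\otimes H^\vee)_n$ is the completion by total degree, with its componentwise tensor-product multiplication; all infinite sums are finite in each total degree. *)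

theory Defs
  imports Complex_Main "HOL-Library.Function_Algebras"
begin

section \<open>Tensor products of vector spaces\<close>

text \<open>
  An \<open>F\<close>-vector space is a type together with a scalar multiplication \<open>s\<close> satisfying
  \<^locale>\<open>vector_space\<close>; the field itself is the vector space with scalar multiplication \<open>(*)\<close>.
\<close>

definition bilinear_map ::
  "('f::field \<Rightarrow> 'a::ab_group_add \<Rightarrow> 'a) \<Rightarrow> ('f \<Rightarrow> 'b::ab_group_add \<Rightarrow> 'b) \<Rightarrow>
   ('f \<Rightarrow> 'c::ab_group_add \<Rightarrow> 'c) \<Rightarrow> ('a \<Rightarrow> 'b \<Rightarrow> 'c) \<Rightarrow> bool" where
  "bilinear_map s1 s2 s3 B \<longleftrightarrow>
     (\<forall>a. Vector_Spaces.linear s2 s3 (\<lambda>b. B a b)) \<and> (\<forall>b. Vector_Spaces.linear s1 s3 (\<lambda>a. B a b))"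

text \<open>
  \<open>V \<otimes> W\<close> is realised as the span of the functionals \<open>a \<otimes> b = (B \<mapsto> B a b)\<close> on the space of
  bilinear forms \<open>B : V \<times> W \<rightarrow> F\<close>. As the type \<open>'a \<Rightarrow> 'b \<Rightarrow> 'f\<close> also has elements that are not
  bilinear, tensors are normalised to vanish there. The lemma \<open>tensor_lift_sum\<close> below gives
  the universal property. Addition of tensors is the pointwise addition of functions.
\<close>

type_synonym ('f, 'a, 'b) tensors = "('a \<Rightarrow> 'b \<Rightarrow> 'f) \<Rightarrow> 'f"

definition tensor ::
  "('f::field \<Rightarrow> 'a::ab_group_add \<Rightarrow> 'a) \<Rightarrow> ('f \<Rightarrow> 'b::ab_group_add \<Rightarrow> 'b) \<Rightarrow>
   'a \<Rightarrow> 'b \<Rightarrow> ('f, 'a, 'b) tensors" where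
  "tensor s1 s2 a b = (\<lambda>B. if bilinear_map s1 s2 (*) B then B a b else 0)"

definition tscale :: "'f::field \<Rightarrow> ('x \<Rightarrow> 'f) \<Rightarrow> ('x \<Rightarrow> 'f)" where
  "tscale c t = (\<lambda>B. c * t B)"

definition tensor_space ::
  "('f::field \<Rightarrow> 'a::ab_group_add \<Rightarrow> 'a) \<Rightarrow> ('f \<Rightarrow> 'b::ab_group_add \<Rightarrow> 'b) \<Rightarrow>
   ('f, 'a, 'b) tensors set" where
  "tensor_space s1 s2 = module.span tscale {tensor s1 s2 a b | a b. True}"

text \<open>
  The value at \<open>t\<close> of the linear map \<open>V \<otimes> W \<rightarrow> X\<close> induced by a bilinear map \<open>B : V \<times> W \<rightarrow> X\<close>,
  determined by its image under all linear functionals \<open>\<phi>\<close> on \<open>X\<close>.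
\<close>

definition tensor_lift ::
  "('f::field \<Rightarrow> 'c::ab_group_add \<Rightarrow> 'c) \<Rightarrow> ('a \<Rightarrow> 'b \<Rightarrow> 'c) \<Rightarrow> ('f, 'a, 'b) tensors \<Rightarrow> 'c" where
  "tensor_lift s3 B t =
     (THE v. \<forall>\<phi>. Vector_Spaces.linear s3 (*) \<phi> \<longrightarrow> \<phi> v = t (\<lambda>a b. \<phi> (B a b)))"

text \<open>\<open>\<phi> \<otimes> \<psi>\<close> for linear maps; \<open>s1\<close> and \<open>s2\<close> belong to the target spaces.\<close>

definition tensor_map ::
  "('f::field \<Rightarrow> 'c::ab_group_add \<Rightarrow> 'c) \<Rightarrow> ('f \<Rightarrow> 'd::ab_group_add \<Rightarrow> 'd) \<Rightarrow>
   ('a \<Rightarrow> 'c) \<Rightarrow> ('b \<Rightarrow> 'd) \<Rightarrow> ('f, 'a, 'b) tensors \<Rightarrow> ('f, 'c, 'd) tensors" where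
  "tensor_map s1 s2 \<phi> \<psi> t =
     (\<lambda>B. if bilinear_map s1 s2 (*) B then t (\<lambda>a b. B (\<phi> a) (\<psi> b)) else 0)"

text \<open>\<open>(a \<otimes> b) (c \<otimes> d) = a c \<otimes> b d\<close>, extended bilinearly.\<close>

definition tensor_mult ::
  "('f::field \<Rightarrow> 'a::ring_1 \<Rightarrow> 'a) \<Rightarrow> ('f \<Rightarrow> 'b::ring_1 \<Rightarrow> 'b) \<Rightarrow>
   ('f, 'a, 'b) tensors \<Rightarrow> ('f, 'a, 'b) tensors \<Rightarrow> ('f, 'a, 'b) tensors" where
  "tensor_mult s1 s2 t u =
     (\<lambda>B. if bilinear_map s1 s2 (*) B then t (\<lambda>a b. u (\<lambda>c d. B (a * c) (b * d))) else 0)"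

text \<open>\<open>\<langle>a \<otimes> b, c \<otimes> d\<rangle> = \<langle>a, c\<rangle> \<langle>b, d\<rangle>\<close>, extended bilinearly.\<close>

definition tensor_pairing ::
  "('a \<Rightarrow> 'c \<Rightarrow> 'f::field) \<Rightarrow> ('b \<Rightarrow> 'd \<Rightarrow> 'f) \<Rightarrow>
   ('f, 'a, 'b) tensors \<Rightarrow> ('f, 'c, 'd) tensors \<Rightarrow> 'f" where
  "tensor_pairing p q t u = t (\<lambda>a b. u (\<lambda>c d. p a c * q b d))"

text \<open>
  \<open>(\<Delta> \<otimes> id) t\<close> and \<open>(id \<otimes> \<Delta>) t\<close> in \<open>V \<otimes> V \<otimes> V\<close>. Triple tensors are realised in the same way,
  as functionals on trilinear forms, with \<open>a \<otimes> b \<otimes> c = (T \<mapsto> T a b c)\<close>.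
\<close>

definition trilinear_form ::
  "('f::field \<Rightarrow> 'a::ab_group_add \<Rightarrow> 'a) \<Rightarrow> ('a \<Rightarrow> 'a \<Rightarrow> 'a \<Rightarrow> 'f) \<Rightarrow> bool" where
  "trilinear_form s T \<longleftrightarrow>
     (\<forall>a b. Vector_Spaces.linear s (*) (\<lambda>c. T a b c)) \<and>
     (\<forall>a c. Vector_Spaces.linear s (*) (\<lambda>b. T a b c)) \<and>
     (\<forall>b c. Vector_Spaces.linear s (*) (\<lambda>a. T a b c))"

definition comult_left ::
  "('f::field \<Rightarrow> 'a::ab_group_add \<Rightarrow> 'a) \<Rightarrow> ('a \<Rightarrow> ('f, 'a, 'a) tensors) \<Rightarrow>
   ('f, 'a, 'a) tensors \<Rightarrow> (('a \<Rightarrow> 'a \<Rightarrow> 'a \<Rightarrow> 'f) \<Rightarrow> 'f)" where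
  "comult_left s \<Delta> t =
     (\<lambda>T. if trilinear_form s T then t (\<lambda>a c. \<Delta> a (\<lambda>a' b. T a' b c)) else 0)"

definition comult_right ::
  "('f::field \<Rightarrow> 'a::ab_group_add \<Rightarrow> 'a) \<Rightarrow> ('a \<Rightarrow> ('f, 'a, 'a) tensors) \<Rightarrow>
   ('f, 'a, 'a) tensors \<Rightarrow> (('a \<Rightarrow> 'a \<Rightarrow> 'a \<Rightarrow> 'f) \<Rightarrow> 'f)" where
  "comult_right s \<Delta> t =
     (\<lambda>T. if trilinear_form s T then t (\<lambda>a b. \<Delta> b (\<lambda>b' c. T a b' c)) else 0)"

subsection \<open>Basic properties\<close>

lemma linear_mapI:
  assumes "vector_space s1" "vector_space s2"
    and "\<And>x y. f (x + y) = f x + f y" "\<And>c x. f (s1 c x) = s2 c (f x)"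
  shows "Vector_Spaces.linear s1 s2 f"
  using assms by (simp add: Vector_Spaces.linear_iff)

lemma bilinear_mapD:
  assumes "bilinear_map s1 s2 s3 B"
  shows "Vector_Spaces.linear s2 s3 (\<lambda>b. B a b)" "Vector_Spaces.linear s1 s3 (\<lambda>a. B a b)"
  using assms by (auto simp: bilinear_map_def)

lemma vector_space_tscale: "vector_space (tscale :: 'f::field \<Rightarrow> ('x \<Rightarrow> 'f) \<Rightarrow> _)"
  by unfold_locales (auto simp: tscale_def fun_eq_iff algebra_simps)

lemma sum_fun_apply: "(\<Sum>i\<in>I. t i) x = (\<Sum>i\<in>I. t i x)"
  by (induction I rule: infinite_finite_induct) auto

lemma functionals_separate:
  fixes s :: "'f::field \<Rightarrow> 'a::ab_group_add \<Rightarrow> 'a"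
  assumes "vector_space s"
    and eq: "\<And>\<phi>. Vector_Spaces.linear s (*) \<phi> \<Longrightarrow> \<phi> v = \<phi> w"
  shows "v = w"
proof (rule ccontr)
  assume ne: "v \<noteq> w"
  interpret vector_space s by fact
  interpret P: vector_space_pair s "(*) :: 'f \<Rightarrow> 'f \<Rightarrow> 'f"
    by unfold_locales (auto simp: algebra_simps)
  have "independent {v - w}" using ne by simp
  from P.linear_independent_extend[OF this, of "\<lambda>_. 1"]
  obtain \<phi> where \<phi>: "Vector_Spaces.linear s (*) \<phi>" "\<phi> (v - w) = 1"
    by (elim exE conjE) simp
  then show False using eq[OF \<phi>(1)] P.linear_diff[OF \<phi>(1), of v w] by simp
qed

lemma bilinear_map_compose:
  assumes "bilinear_map s1 s2 s3 B" "Vector_Spaces.linear s3 s4 \<phi>"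
  shows "bilinear_map s1 s2 s4 (\<lambda>a b. \<phi> (B a b))"
  unfolding bilinear_map_def
  using bilinear_mapD[OF assms(1), THEN Vector_Spaces.linear_compose[OF _ assms(2)]]
  by (simp add: comp_def)

lemma tensor_apply: "bilinear_map s1 s2 (*) B \<Longrightarrow> tensor s1 s2 a b B = B a b"
  by (simp add: tensor_def)

lemma tensor_bilinear:
  assumes "vector_space s1" "vector_space s2"
  shows "bilinear_map s1 s2 tscale (tensor s1 s2)"
proof -
  have lin: "B (a + a') b = B a b + B a' b" "B (s1 c a) b = c * B a b"
    "B a (b + b') = B a b + B a b'" "B a (s2 c b) = c * B a b"
    if "bilinear_map s1 s2 (*) B" for B and a a' b b' c
    using bilinear_mapD[OF that] by (simp_all add: Vector_Spaces.linear_iff)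
  show ?thesis
    unfolding bilinear_map_def
    by (auto intro!: linear_mapI assms vector_space_tscale simp: tensor_def tscale_def fun_eq_iff lin)
qed

lemma bilinear_map_precompose:
  assumes "bilinear_map s1 s2 s3 B" "Vector_Spaces.linear t1 s1 \<phi>" "Vector_Spaces.linear t2 s2 \<psi>"
  shows "bilinear_map t1 t2 s3 (\<lambda>a b. B (\<phi> a) (\<psi> b))"
  unfolding bilinear_map_def
  using bilinear_mapD(1)[OF assms(1), THEN Vector_Spaces.linear_compose[OF assms(3)]]
    bilinear_mapD(2)[OF assms(1), THEN Vector_Spaces.linear_compose[OF assms(2)]]
  by (simp add: comp_def)

lemma tensor_map_tensor:
  assumes "Vector_Spaces.linear t1 s1 \<phi>" "Vector_Spaces.linear t2 s2 \<psi>"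
  shows "tensor_map s1 s2 \<phi> \<psi> (tensor t1 t2 a b) = tensor s1 s2 (\<phi> a) (\<psi> b)"
  by (auto simp: tensor_map_def tensor_def fun_eq_iff bilinear_map_precompose[OF _ assms])

lemma tensor_mult_tensor:
  assumes "bilinear_map s1 s1 s1 (*)" "bilinear_map s2 s2 s2 (*)"
  shows "tensor_mult s1 s2 (tensor s1 s2 a b) (tensor s1 s2 c d) = tensor s1 s2 (a * c) (b * d)"
proof -
  have "bilinear_map s1 s2 (*) (\<lambda>c d. B (a * c) (b * d))"
    and "bilinear_map s1 s2 (*) (\<lambda>a b. B (a * c) (b * d))"
    if "bilinear_map s1 s2 (*) B" for B a b c d
    using bilinear_map_precompose[OF that bilinear_mapD(1)[OF assms(1)] bilinear_mapD(1)[OF assms(2)]]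
      bilinear_map_precompose[OF that bilinear_mapD(2)[OF assms(1)] bilinear_mapD(2)[OF assms(2)]]
    by blast+
  then show ?thesis
    by (simp add: tensor_mult_def tensor_def fun_eq_iff)
qed

lemma tensor_lift_sum:
  fixes s3 :: "'f::field \<Rightarrow> 'c::ab_group_add \<Rightarrow> 'c"
  assumes B: "bilinear_map s1 s2 s3 B"
  shows "tensor_lift s3 B (\<Sum>i\<in>I. tensor s1 s2 (a i) (b i)) = (\<Sum>i\<in>I. B (a i) (b i))"
proof -
  have V3: "vector_space s3"
    using bilinear_mapD(1)[OF B] by (simp add: Vector_Spaces.linear_def)
  have *: "\<phi> (\<Sum>i\<in>I. B (a i) (b i)) = (\<Sum>i\<in>I. tensor s1 s2 (a i) (b i)) (\<lambda>a b. \<phi> (B a b))"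
    if \<phi>: "Vector_Spaces.linear s3 (*) \<phi>" for \<phi>
  proof -
    interpret \<phi>: Vector_Spaces.linear s3 "(*)" \<phi> by fact
    show ?thesis
      by (simp add: \<phi>.sum sum_fun_apply tensor_apply[OF bilinear_map_compose[OF B \<phi>]])
  qed
  show ?thesis
    unfolding tensor_lift_def
  proof (rule the_equality)
    show "\<forall>\<phi>. Vector_Spaces.linear s3 (*) \<phi> \<longrightarrow>
      \<phi> (\<Sum>i\<in>I. B (a i) (b i)) = (\<Sum>i\<in>I. tensor s1 s2 (a i) (b i)) (\<lambda>a b. \<phi> (B a b))"
      using * by blast
  next
    fix v assume "\<forall>\<phi>. Vector_Spaces.linear s3 (*) \<phi> \<longrightarrow>
      \<phi> v = (\<Sum>i\<in>I. tensor s1 s2 (a i) (b i)) (\<lambda>a b. \<phi> (B a b))"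
    then show "v = (\<Sum>i\<in>I. B (a i) (b i))"
      by (intro functionals_separate[OF V3]) (simp add: *)
  qed
qed

section \<open>Graded connected Hopf algebras\<close>

definition direct_sum_decomposition ::
  "('f::field \<Rightarrow> 'a::ab_group_add \<Rightarrow> 'a) \<Rightarrow> (nat \<Rightarrow> 'a set) \<Rightarrow> bool" where
  "direct_sum_decomposition s A \<longleftrightarrow>
     (\<forall>n. module.subspace s (A n)) \<and>
     (\<forall>x. \<exists>!c. (\<forall>n. c n \<in> A n) \<and> finite {n. c n \<noteq> 0} \<and> x = (\<Sum>n | c n \<noteq> 0. c n))"

definition hom_component :: "(nat \<Rightarrow> 'a::ab_group_add set) \<Rightarrow> nat \<Rightarrow> 'a \<Rightarrow> 'a" where
  "hom_component A n x =
     (THE c. (\<forall>n. c n \<in> A n) \<and> finite {n. c n \<noteq> 0} \<and> x = (\<Sum>n | c n \<noteq> 0. c n)) n"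

definition tensor_degree ::
  "('f::field \<Rightarrow> 'a::ab_group_add \<Rightarrow> 'a) \<Rightarrow> ('f \<Rightarrow> 'b::ab_group_add \<Rightarrow> 'b) \<Rightarrow>
   (nat \<Rightarrow> 'a set) \<Rightarrow> (nat \<Rightarrow> 'b set) \<Rightarrow> nat \<Rightarrow> ('f, 'a, 'b) tensors set" where
  "tensor_degree s1 s2 A B n =
     module.span tscale {tensor s1 s2 a b | a b i j. i + j = n \<and> a \<in> A i \<and> b \<in> B j}"

text \<open>
  The underlying ring (multiplication and unit) is the type class structure of \<open>'a\<close>, with unit map
  \<open>c \<mapsto> s c 1\<close>.
\<close>

locale graded_connected_hopf_algebra = vector_space s
  for s :: "'f::field \<Rightarrow> 'a::ring_1 \<Rightarrow> 'a" +
  fixes A :: "nat \<Rightarrow> 'a set"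
    and \<Delta> :: "'a \<Rightarrow> ('f, 'a, 'a) tensors"
    and \<epsilon> :: "'a \<Rightarrow> 'f"
    and S :: "'a \<Rightarrow> 'a"
  assumes mult_bilinear: "bilinear_map s s s (*)"
    and comult_linear: "Vector_Spaces.linear s tscale \<Delta>"
    and comult_tensor: "\<Delta> x \<in> tensor_space s s"
    and counit_linear: "Vector_Spaces.linear s (*) \<epsilon>"
    and antipode_linear: "Vector_Spaces.linear s s S"
    and coassoc: "comult_left s \<Delta> (\<Delta> x) = comult_right s \<Delta> (\<Delta> x)"
    and counit_left: "tensor_lift s (\<lambda>a b. s (\<epsilon> a) b) (\<Delta> x) = x"
    and counit_right: "tensor_lift s (\<lambda>a b. s (\<epsilon> b) a) (\<Delta> x) = x"
    and comult_mult: "\<Delta> (x * y) = tensor_mult s s (\<Delta> x) (\<Delta> y)"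
    and comult_one: "\<Delta> 1 = tensor s s 1 1"
    and counit_mult: "\<epsilon> (x * y) = \<epsilon> x * \<epsilon> y"
    and counit_one: "\<epsilon> 1 = 1"
    and antipode_left: "tensor_lift s (\<lambda>a b. S a * b) (\<Delta> x) = s (\<epsilon> x) 1"
    and antipode_right: "tensor_lift s (\<lambda>a b. a * S b) (\<Delta> x) = s (\<epsilon> x) 1"
    and grading: "direct_sum_decomposition s A"
    and mult_graded: "x \<in> A i \<Longrightarrow> y \<in> A j \<Longrightarrow> x * y \<in> A (i + j)"
    and comult_graded: "x \<in> A n \<Longrightarrow> \<Delta> x \<in> tensor_degree s s A A n"
    and counit_graded: "x \<in> A n \<Longrightarrow> n > 0 \<Longrightarrow> \<epsilon> x = 0"
    and antipode_graded: "x \<in> A n \<Longrightarrow> S x \<in> A n"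
    and connected: "A 0 = range (\<lambda>c. s c 1)"

definition finite_dimensional_pieces ::
  "('f::field \<Rightarrow> 'a::ab_group_add \<Rightarrow> 'a) \<Rightarrow> (nat \<Rightarrow> 'a set) \<Rightarrow> bool" where
  "finite_dimensional_pieces s A \<longleftrightarrow> (\<forall>n. \<exists>X. finite X \<and> A n = module.span s X)"

definition graded_nondegenerate_hopf_pairing ::
  "('f::field \<Rightarrow> 'a::ring_1 \<Rightarrow> 'a) \<Rightarrow> (nat \<Rightarrow> 'a set) \<Rightarrow> ('a \<Rightarrow> ('f, 'a, 'a) tensors) \<Rightarrow>
   ('f \<Rightarrow> 'b::ring_1 \<Rightarrow> 'b) \<Rightarrow> (nat \<Rightarrow> 'b set) \<Rightarrow> ('b \<Rightarrow> ('f, 'b, 'b) tensors) \<Rightarrow>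
   ('a \<Rightarrow> 'b \<Rightarrow> 'f) \<Rightarrow> bool" where
  "graded_nondegenerate_hopf_pairing s1 A \<Delta>1 s2 B \<Delta>2 p \<longleftrightarrow>
     bilinear_map s1 s2 (*) p \<and>
     (\<forall>i j. i \<noteq> j \<longrightarrow> (\<forall>a\<in>A i. \<forall>c\<in>B j. p a c = 0)) \<and>
     (\<forall>n. (\<forall>a\<in>A n. (\<forall>c\<in>B n. p a c = 0) \<longrightarrow> a = 0) \<and>
          (\<forall>c\<in>B n. (\<forall>a\<in>A n. p a c = 0) \<longrightarrow> c = 0)) \<and>
     (\<forall>a b c. p (a * b) c = tensor_pairing p p (tensor s1 s1 a b) (\<Delta>2 c)) \<and>
     (\<forall>a b c. p a (b * c) = tensor_pairing p p (\<Delta>1 a) (tensor s2 s2 b c))"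

definition is_basis ::
  "('f::field \<Rightarrow> 'a::ab_group_add \<Rightarrow> 'a) \<Rightarrow> ('i \<Rightarrow> 'a) \<Rightarrow> bool" where
  "is_basis s f \<longleftrightarrow>
     inj f \<and> \<not> module.dependent s (range f) \<and> module.span s (range f) = UNIV"

definition homogeneous_dual_bases ::
  "('f::field \<Rightarrow> 'a::ab_group_add \<Rightarrow> 'a) \<Rightarrow> (nat \<Rightarrow> 'a set) \<Rightarrow>
   ('f \<Rightarrow> 'b::ab_group_add \<Rightarrow> 'b) \<Rightarrow> (nat \<Rightarrow> 'b set) \<Rightarrow>
   ('a \<Rightarrow> 'b \<Rightarrow> 'f) \<Rightarrow> ('i \<Rightarrow> 'a) \<Rightarrow> ('i \<Rightarrow> 'b) \<Rightarrow> bool" where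
  "homogeneous_dual_bases s1 A s2 B p f g \<longleftrightarrow>
     is_basis s1 f \<and> is_basis s2 g \<and>
     (\<forall>l. \<exists>n. f l \<in> A n \<and> g l \<in> B n) \<and>
     (\<forall>l m. p (f l) (g m) = (if l = m then 1 else 0))"

text \<open>
  \<open>skew s \<Delta> f l m\<close> is \<open>f\<^bsub>l/m\<^esub>\<close>, from \<open>\<Delta> (f\<^bsub>l\<^esub>) = \<Sum>\<^sub>m f\<^bsub>l/m\<^esub> \<otimes> f\<^bsub>m\<^esub>\<close>. Existence and uniqueness of this
  expansion is the lemma \<open>skew_ex1\<close> below.
\<close>

definition skew ::
  "('f::field \<Rightarrow> 'a::ab_group_add \<Rightarrow> 'a) \<Rightarrow> ('a \<Rightarrow> ('f, 'a, 'a) tensors) \<Rightarrow> ('i \<Rightarrow> 'a) \<Rightarrow>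
   'i \<Rightarrow> 'i \<Rightarrow> 'a" where
  "skew s \<Delta> f l =
     (THE h. finite {m. h m \<noteq> 0} \<and> \<Delta> (f l) = (\<Sum>m | h m \<noteq> 0. tensor s s (h m) (f m)))"

lemma skew_ex1:
  fixes s :: "'f::field \<Rightarrow> 'a::ab_group_add \<Rightarrow> 'a" and f :: "'i \<Rightarrow> 'a"
  assumes "vector_space s" "is_basis s f" "t \<in> tensor_space s s"
  shows "\<exists>!h. finite {m. h m \<noteq> 0} \<and> t = (\<Sum>m | h m \<noteq> 0. tensor s s (h m) (f m))"
proof -
  interpret V: vector_space s by fact
  interpret T: vector_space "tscale :: 'f \<Rightarrow> ((('a \<Rightarrow> 'a \<Rightarrow> 'f) \<Rightarrow> 'f) \<Rightarrow> _)"
    by (rule vector_space_tscale)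
  interpret P: vector_space_pair s "(*) :: 'f \<Rightarrow> 'f \<Rightarrow> 'f"
    by unfold_locales (auto simp: algebra_simps)
  interpret VT: vector_space_pair s "tscale :: 'f \<Rightarrow> ((('a \<Rightarrow> 'a \<Rightarrow> 'f) \<Rightarrow> 'f) \<Rightarrow> _)" ..
  have inj: "inj f" and ind: "V.independent (range f)" and sp: "V.span (range f) = UNIV"
    using assms(2) by (auto simp: is_basis_def)
  note bil = tensor_bilinear[OF assms(1) assms(1)]
  note lin1 = bilinear_mapD(2)[OF bil] and lin2 = bilinear_mapD(1)[OF bil]
  note add1 = VT.linear_add[OF lin1] and scale1 = VT.linear_scale[OF lin1]
    and zero1 [simp] = VT.linear_0[OF lin1]
  have supp: "(\<Sum>m | h m \<noteq> 0. tensor s s (h m) (f m)) = (\<Sum>m\<in>M. tensor s s (h m) (f m))"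
    if "finite M" "{m. h m \<noteq> 0} \<subseteq> M" for h :: "'i \<Rightarrow> 'a" and M
    by (rule sum.mono_neutral_left) (use that in auto)
  define R where "R = (\<lambda>t. \<exists>h M. finite M \<and> {m. h m \<noteq> 0} \<subseteq> M \<and> t = (\<Sum>m\<in>M. tensor s s (h m) (f m)))"
  have R_add: "R (t + u)" if "R t" "R u" for t u
  proof -
    from that obtain h M k N where
      h: "finite M" "{m. h m \<noteq> 0} \<subseteq> M" "t = (\<Sum>m\<in>M. tensor s s (h m) (f m))" and
      k: "finite N" "{m. k m \<noteq> 0} \<subseteq> N" "u = (\<Sum>m\<in>N. tensor s s (k m) (f m))"
      unfolding R_def by blast
    have z: "h m = 0" if "m \<notin> M" for m using h(2) that by blast
    have z': "k m = 0" if "m \<notin> N" for m using k(2) that by blast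
    have "t = (\<Sum>m\<in>M \<union> N. tensor s s (h m) (f m))"
      unfolding h(3) by (rule sum.mono_neutral_left) (use h(1) k(1) z in auto)
    moreover have "u = (\<Sum>m\<in>M \<union> N. tensor s s (k m) (f m))"
      unfolding k(3) by (rule sum.mono_neutral_left) (use h(1) k(1) z' in auto)
    ultimately have "t + u = (\<Sum>m\<in>M \<union> N. tensor s s (h m + k m) (f m))"
      by (simp add: sum.distrib add1)
    moreover have "{m. h m + k m \<noteq> 0} \<subseteq> M \<union> N" using h(2) k(2) by force
    ultimately show ?thesis unfolding R_def using h(1) k(1)
      by (intro exI[of _ "\<lambda>m. h m + k m"] exI[of _ "M \<union> N"]) simp
  qed
  have R_scale: "R (tscale c t)" if "R t" for c t
  proof -
    from that obtain h M where
      h: "finite M" "{m. h m \<noteq> 0} \<subseteq> M" "t = (\<Sum>m\<in>M. tensor s s (h m) (f m))"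
      unfolding R_def by blast
    have "tscale c t = (\<Sum>m\<in>M. tensor s s (s c (h m)) (f m))"
      unfolding h(3) by (simp add: T.scale_sum_right scale1)
    moreover have "{m. s c (h m) \<noteq> 0} \<subseteq> M" using h(2) by auto
    ultimately show ?thesis unfolding R_def using h(1)
      by (intro exI[of _ "\<lambda>m. s c (h m)"] exI[of _ M]) simp
  qed
  have R_zero: "R 0" unfolding R_def
    by (intro exI[of _ "\<lambda>_. 0"] exI[of _ "{}"]) simp
  have R_tensor: "R (tensor s s a b)" for a b
  proof -
    have "b \<in> V.span (range f)" using sp by simp
    then show ?thesis
    proof (induction rule: V.span_induct_alt)
      case base
      have "tensor s s a 0 = 0" by (rule VT.linear_0[OF lin2])
      then show ?case using R_zero by (simp only:)
    next
      case (step c x y)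
      then obtain m where x: "x = f m" by auto
      have "R (tensor s s a x)" unfolding R_def x
        by (intro exI[of _ "\<lambda>k. if k = m then a else 0"] exI[of _ "{m}"]) auto
      moreover have "tensor s s a (s c x + y) = tscale c (tensor s s a x) + tensor s s a y"
        by (simp only: VT.linear_add[OF lin2] VT.linear_scale[OF lin2])
      ultimately show ?case using step.IH by (simp only: R_add R_scale)
    qed
  qed
  have "R t"
    using assms(3) unfolding tensor_space_def
  proof (induction rule: T.span_induct_alt)
    case base
    show ?case by (rule R_zero)
  next
    case (step c x y)
    then have "R x" using R_tensor by blast
    then show ?case using step by (intro R_add R_scale)
  qed
  then obtain h M where h: "finite M" "{m. h m \<noteq> 0} \<subseteq> M" "t = (\<Sum>m\<in>M. tensor s s (h m) (f m))"
    unfolding R_def by blast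
  show ?thesis
  proof (rule ex1I[of _ h], goal_cases)
    case 1
    show ?case using h by (simp add: supp finite_subset)
  next
    case (2 k)
    then have k: "finite {m. k m \<noteq> 0}" "t = (\<Sum>m | k m \<noteq> 0. tensor s s (k m) (f m))" by auto
    show "k = h"
    proof
      fix n
      obtain \<psi> where \<psi>1: "Vector_Spaces.linear s (*) \<psi>"
        and "\<forall>x\<in>range f. \<psi> x = (if x = f n then 1 else (0::'f))"
        using P.linear_independent_extend[OF ind, of "\<lambda>x. if x = f n then 1 else 0"]
        by (elim exE conjE) (rule that)
      then have \<psi>2: "\<psi> (f m) = (if m = n then 1 else 0)" for m
        using inj by (simp add: inj_eq)
      show "k n = h n"
      proof (rule functionals_separate[OF assms(1)])
        fix \<phi> assume \<phi>: "Vector_Spaces.linear s (*) \<phi>"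
        have b: "bilinear_map s s (*) (\<lambda>x y. \<phi> x * \<psi> y)"
          unfolding bilinear_map_def
          by (intro conjI allI linear_mapI[OF assms(1) P.vs2.vector_space_axioms])
            (simp_all only: P.linear_add[OF \<phi>] P.linear_add[OF \<psi>1] P.linear_scale[OF \<phi>]
              P.linear_scale[OF \<psi>1] distrib_left distrib_right mult.assoc mult.left_commute)
        have val: "t (\<lambda>x y. \<phi> x * \<psi> y) = \<phi> (q n)"
          if "finite N" "{m. q m \<noteq> 0} \<subseteq> N" "t = (\<Sum>m\<in>N. tensor s s (q m) (f m))" for q N
        proof -
          have "t (\<lambda>x y. \<phi> x * \<psi> y) = (\<Sum>m\<in>N. \<phi> (q m) * (if m = n then 1 else 0))"
            unfolding that(3) by (simp add: sum_fun_apply tensor_apply[OF b] \<psi>2)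
          also have "\<dots> = (\<Sum>m\<in>N. if m = n then \<phi> (q m) else 0)"
            by (rule sum.cong) auto
          also have "\<dots> = \<phi> (q n)"
            using that(1,2) P.linear_0[OF \<phi>] by (cases "q n = 0") (auto simp: sum.delta)
          finally show ?thesis .
        qed
        show "\<phi> (k n) = \<phi> (h n)"
          using val[OF k(1) _ k(2)] val[OF h] by simp
      qed
    qed
  qed
qed

lemma (in graded_connected_hopf_algebra) skew_expansion:
  assumes "is_basis s f"
  shows "finite {m. skew s \<Delta> f l m \<noteq> 0}"
    and "\<Delta> (f l) = (\<Sum>m | skew s \<Delta> f l m \<noteq> 0. tensor s s (skew s \<Delta> f l m) (f m))"
proof -
  note ex = theI'[OF skew_ex1[OF vector_space_axioms assms comult_tensor]]
  show "finite {m. skew s \<Delta> f l m \<noteq> 0}"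
    unfolding skew_def by (rule conjunct1[OF ex])
  show "\<Delta> (f l) = (\<Sum>m | skew s \<Delta> f l m \<noteq> 0. tensor s s (skew s \<Delta> f l m) (f m))"
    unfolding skew_def by (rule conjunct2[OF ex])
qed

section \<open>The completed tensor product\<close>

text \<open>
  An element of the completion is the sequence of its components of total degree \<open>0, 1, 2, \<dots>\<close>.
  \<open>completed\<close> is the canonical map \<open>V \<otimes> W \<rightarrow> \<Prod>\<^sub>n (V \<otimes> W)\<^sub>n\<close>.
\<close>

type_synonym ('f, 'a, 'b) completion = "nat \<Rightarrow> ('f, 'a, 'b) tensors"

definition completed ::
  "('f::field \<Rightarrow> 'a::ab_group_add \<Rightarrow> 'a) \<Rightarrow> (nat \<Rightarrow> 'a set) \<Rightarrow>
   ('f \<Rightarrow> 'b::ab_group_add \<Rightarrow> 'b) \<Rightarrow> (nat \<Rightarrow> 'b set) \<Rightarrow>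
   ('f, 'a, 'b) tensors \<Rightarrow> ('f, 'a, 'b) completion" where
  "completed s1 A s2 B t =
     (\<lambda>n. \<Sum>i\<le>n. tensor_map s1 s2 (hom_component A i) (hom_component B (n - i)) t)"

definition completion_mult ::
  "('f::field \<Rightarrow> 'a::ring_1 \<Rightarrow> 'a) \<Rightarrow> ('f \<Rightarrow> 'b::ring_1 \<Rightarrow> 'b) \<Rightarrow>
   ('f, 'a, 'b) completion \<Rightarrow> ('f, 'a, 'b) completion \<Rightarrow> ('f, 'a, 'b) completion" where
  "completion_mult s1 s2 x y = (\<lambda>n. \<Sum>i\<le>n. tensor_mult s1 s2 (x i) (y (n - i)))"

definition degreewise_finite :: "('i \<Rightarrow> nat \<Rightarrow> 't::comm_monoid_add) \<Rightarrow> bool" where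
  "degreewise_finite x \<longleftrightarrow> (\<forall>n. finite {i. x i n \<noteq> 0})"

text \<open>Meaningful for \<^const>\<open>degreewise_finite\<close> families.\<close>

definition completion_sum :: "('i \<Rightarrow> nat \<Rightarrow> 't::comm_monoid_add) \<Rightarrow> nat \<Rightarrow> 't" where
  "completion_sum x = (\<lambda>n. \<Sum>i | x i n \<noteq> 0. x i n)"

end

theory Submission
  imports Defs
begin

text \<open>
  Pairing with \<open>c \<otimes> d\<close> for \<open>c \<in> H\<^sup>\<or>\<close>, \<open>d \<in> H\<close> turns elements of the completion into bilinear forms,
  and products into convolution products. The element \<open>\<E>\<close> becomes \<open>\<langle>d, c\<rangle>\<close>, and since
  \<open>\<langle>f\<^bsub>l/t\<^esub>, c\<rangle> = \<langle>f\<^sub>l, c g\<^sub>t\<rangle>\<close> and \<open>\<langle>d, g\<^bsub>r/l\<^esub>\<rangle> = \<langle>d f\<^sub>l, g\<^sub>r\<rangle>\<close>, both sides of the first identity become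
  \<open>\<langle>d f\<^sub>l, c g\<^sub>m\<rangle>\<close>: on the right by expansion in dual bases, on the left because \<open>\<Delta>\<close> is multiplicative.
  For the second identity, multiply the first by \<open>1 \<otimes> S(g\<^bsub>e/m\<^esub>)\<close> and sum over \<open>m\<close>; coassociativity
  gives \<open>\<Delta>(g\<^bsub>e/t\<^esub>) = \<Sum>\<^sub>m g\<^bsub>e/m\<^esub> \<otimes> g\<^bsub>m/t\<^esub>\<close>, so \<open>\<Sum>\<^sub>m S(g\<^bsub>e/m\<^esub>) g\<^bsub>m/t\<^esub> = \<epsilon>(g\<^bsub>e/t\<^esub>) = \<delta>\<^bsub>e,t\<^esub>\<close>.
\<close>

section \<open>Tensors as finite sums of pure tensors\<close>

lemma bilinear_formI:
  assumes "vector_space s1" "vector_space s2"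
    and "\<And>a a' b. B (a + a') b = B a b + B a' b" "\<And>k a b. B (s1 k a) b = k * B a b"
    and "\<And>a b b'. B a (b + b') = B a b + B a b'" "\<And>k a b. B a (s2 k b) = k * B a b"
  shows "bilinear_map s1 s2 (*) B"
proof -
  have "vector_space ((*) :: 'a \<Rightarrow> 'a \<Rightarrow> 'a)"
    by unfold_locales (auto simp: algebra_simps)
  then show ?thesis
    unfolding bilinear_map_def using assms by (auto intro!: linear_mapI)
qed

lemma bilinear_formD:
  assumes "bilinear_map s1 s2 (*) B"
  shows "B (a + a') b = B a b + B a' b" "B (s1 k a) b = k * B a b"
    "B a (b + b') = B a b + B a b'" "B a (s2 k b) = k * B a b"
  using bilinear_mapD[OF assms] by (simp_all add: Vector_Spaces.linear_iff)

lemma sum_tensor_apply: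
  assumes "bilinear_map s1 s2 (*) B"
  shows "(\<Sum>u\<in>U. tensor s1 s2 (a u) (b u)) B = (\<Sum>u\<in>U. B (a u) (b u))"
  by (simp add: sum_fun_apply tensor_apply[OF assms])

text \<open>The coefficients of a linear combination are absorbed into the first factors, so
  \<open>P\<close> has to be stable under scaling there. The predicate lets one argument serve both
  arbitrary and bihomogeneous tensors.\<close>

lemma span_tensorE:
  fixes s1 :: "'f::field \<Rightarrow> 'a::ab_group_add \<Rightarrow> 'a" and s2 :: "'f \<Rightarrow> 'b::ab_group_add \<Rightarrow> 'b"
    and t :: "('f, 'a, 'b) tensors"
  assumes "vector_space s1" "vector_space s2"
    and "t \<in> module.span tscale {tensor s1 s2 a b | a b. P a b}"
    and scale: "\<And>k a b. P a b \<Longrightarrow> P (s1 k a) b"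
  obtains U :: "('f, 'a, 'b) tensors set" and a b
  where "finite U" "t = (\<Sum>u\<in>U. tensor s1 s2 (a u) (b u))" "\<And>u. u \<in> U \<Longrightarrow> P (a u) (b u)"
proof -
  interpret T: vector_space "tscale :: 'f \<Rightarrow> ('f, 'a, 'b) tensors \<Rightarrow> _"
    by (rule vector_space_tscale)
  obtain U r where U: "finite U" "U \<subseteq> {tensor s1 s2 a b | a b. P a b}"
    "t = (\<Sum>u\<in>U. tscale (r u) u)"
    using assms(3)[unfolded T.span_explicit mem_Collect_eq] by (elim exE conjE) (rule that)
  then have "\<forall>u\<in>U. \<exists>a b. u = tensor s1 s2 a b \<and> P a b" by blast
  then obtain a b where ab: "\<And>u. u \<in> U \<Longrightarrow> u = tensor s1 s2 (a u) (b u) \<and> P (a u) (b u)"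
    by metis
  have lin: "tscale k (tensor s1 s2 x y) = tensor s1 s2 (s1 k x) y" for k x y
    using bilinear_mapD(2)[OF tensor_bilinear[OF assms(1,2)], of y]
    by (simp add: Vector_Spaces.linear_iff)
  have "t = (\<Sum>u\<in>U. tensor s1 s2 (s1 (r u) (a u)) (b u))"
    unfolding U(3)
  proof (rule sum.cong)
    fix u assume "u \<in> U"
    then have "u = tensor s1 s2 (a u) (b u)" using ab by blast
    then show "tscale (r u) u = tensor s1 s2 (s1 (r u) (a u)) (b u)" using lin by metis
  qed simp
  with U(1) scale ab show thesis
    by (intro that[of U "\<lambda>u. s1 (r u) (a u)" b]) auto
qed

lemma tensor_spaceE:
  fixes s1 :: "'f::field \<Rightarrow> 'a::ab_group_add \<Rightarrow> 'a" and s2 :: "'f \<Rightarrow> 'b::ab_group_add \<Rightarrow> 'b"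
    and t :: "('f, 'a, 'b) tensors"
  assumes "vector_space s1" "vector_space s2" "t \<in> tensor_space s1 s2"
  obtains U :: "('f, 'a, 'b) tensors set" and a b
  where "finite U" "t = (\<Sum>u\<in>U. tensor s1 s2 (a u) (b u))"
proof (rule span_tensorE[OF assms(1,2), of t "\<lambda>_ _. True"])
  show "t \<in> module.span tscale {tensor s1 s2 a b | a b. True}"
    using assms(3) by (simp only: tensor_space_def)
next
  fix U :: "('f, 'a, 'b) tensors set" and a b
  assume "finite U" "t = (\<Sum>u\<in>U. tensor s1 s2 (a u) (b u))"
  then show thesis by (rule that)
qed (rule TrueI)

lemma tensor_space_tensor [intro]:
  fixes s1 :: "'f::field \<Rightarrow> 'a::ab_group_add \<Rightarrow> 'a" and s2 :: "'f \<Rightarrow> 'b::ab_group_add \<Rightarrow> 'b"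
  shows "tensor s1 s2 a b \<in> tensor_space s1 s2"
proof -
  interpret T: vector_space "tscale :: 'f \<Rightarrow> ('f, 'a, 'b) tensors \<Rightarrow> _"
    by (rule vector_space_tscale)
  show ?thesis unfolding tensor_space_def by (rule T.span_base) blast
qed

lemma tensor_space_sum [intro]:
  fixes s1 :: "'f::field \<Rightarrow> 'a::ab_group_add \<Rightarrow> 'a" and s2 :: "'f \<Rightarrow> 'b::ab_group_add \<Rightarrow> 'b"
  assumes "\<And>i. i \<in> I \<Longrightarrow> t i \<in> tensor_space s1 s2"
  shows "(\<Sum>i\<in>I. t i) \<in> tensor_space s1 s2"
proof -
  interpret T: vector_space "tscale :: 'f \<Rightarrow> ('f, 'a, 'b) tensors \<Rightarrow> _"
    by (rule vector_space_tscale)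
  show ?thesis using assms unfolding tensor_space_def by (rule T.span_sum)
qed

text \<open>A tensor is a function on all two-argument maps; it is its form as a finite sum of
  evaluations that makes it linear on bilinear forms and zero elsewhere.\<close>

lemma
  fixes s1 :: "'f::field \<Rightarrow> 'a::ab_group_add \<Rightarrow> 'a" and s2 :: "'f \<Rightarrow> 'b::ab_group_add \<Rightarrow> 'b"
  assumes "vector_space s1" "vector_space s2" "t \<in> tensor_space s1 s2"
  shows tensor_space_apply_nonbilinear: "\<not> bilinear_map s1 s2 (*) B \<Longrightarrow> t B = 0"
    and tensor_space_apply_sum: "\<lbrakk>finite I; \<And>i. i \<in> I \<Longrightarrow> bilinear_map s1 s2 (*) (C i)\<rbrakk> \<Longrightarrow>
      t (\<lambda>a b. \<Sum>i\<in>I. k i * C i a b) = (\<Sum>i\<in>I. k i * t (C i))"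
proof -
  obtain U :: "('f, 'a, 'b) tensors set" and a b
    where U: "finite U" "t = (\<Sum>u\<in>U. tensor s1 s2 (a u) (b u))"
    using assms by (rule tensor_spaceE)
  show "t B = 0" if "\<not> bilinear_map s1 s2 (*) B"
    using that by (simp add: U(2) sum_fun_apply tensor_def)
  show "t (\<lambda>a b. \<Sum>i\<in>I. k i * C i a b) = (\<Sum>i\<in>I. k i * t (C i))"
    if I: "finite I" "\<And>i. i \<in> I \<Longrightarrow> bilinear_map s1 s2 (*) (C i)"
  proof -
    have "bilinear_map s1 s2 (*) (\<lambda>a b. \<Sum>i\<in>I. k i * C i a b)"
      by (rule bilinear_formI[OF assms(1,2)])
        (simp_all add: bilinear_formD[OF I(2)] algebra_simps sum.distrib sum_distrib_left)
    then have "t (\<lambda>a b. \<Sum>i\<in>I. k i * C i a b) = (\<Sum>u\<in>U. \<Sum>i\<in>I. k i * C i (a u) (b u))"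
      by (simp add: U(2) sum_tensor_apply)
    also have "\<dots> = (\<Sum>i\<in>I. \<Sum>u\<in>U. k i * C i (a u) (b u))" by (rule sum.swap)
    also have "\<dots> = (\<Sum>i\<in>I. k i * t (C i))"
      by (simp add: U(2) sum_tensor_apply[OF I(2)] sum_distrib_left)
    finally show ?thesis .
  qed
qed

lemma tensor_mult_sum:
  fixes s1 :: "'f::field \<Rightarrow> 'a::ring_1 \<Rightarrow> 'a" and s2 :: "'f \<Rightarrow> 'b::ring_1 \<Rightarrow> 'b"
  assumes bil: "bilinear_map s1 s1 s1 (*)" "bilinear_map s2 s2 s2 (*)"
  shows "tensor_mult s1 s2 (\<Sum>u\<in>U. tensor s1 s2 (a u) (b u)) (\<Sum>v\<in>V. tensor s1 s2 (c v) (d v)) =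
    (\<Sum>u\<in>U. \<Sum>v\<in>V. tensor s1 s2 (a u * c v) (b u * d v))" (is "?l = ?r")
proof
  fix B :: "'a \<Rightarrow> 'b \<Rightarrow> 'f"
  have vs: "vector_space s1" "vector_space s2"
    using bilinear_mapD(1)[OF bil(1)] bilinear_mapD(1)[OF bil(2)]
    by (simp_all add: Vector_Spaces.linear_iff)
  show "?l B = ?r B"
  proof (cases "bilinear_map s1 s2 (*) B")
    case True
    note D = bilinear_formD[OF True]
    have M: "s1 k x * y = s1 k (x * y)" "x * s1 k y = s1 k (x * y)" for k x y
      using bilinear_mapD[OF bil(1)] by (auto simp: Vector_Spaces.linear_iff)
    have N: "s2 k x * y = s2 k (x * y)" "x * s2 k y = s2 k (x * y)" for k x y
      using bilinear_mapD[OF bil(2)] by (auto simp: Vector_Spaces.linear_iff)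
    have 1: "bilinear_map s1 s2 (*) (\<lambda>c d. B (a * c) (b * d))" for a b
      by (rule bilinear_formI[OF vs]) (simp_all add: D M N algebra_simps)
    have 2: "bilinear_map s1 s2 (*) (\<lambda>a b. \<Sum>v\<in>V. B (a * c v) (b * d v))"
      by (rule bilinear_formI[OF vs]) (simp_all add: D M N algebra_simps sum.distrib sum_distrib_left)
    show ?thesis
      by (simp add: True tensor_mult_def sum_tensor_apply[OF 1] sum_tensor_apply[OF 2])
        (simp add: True sum_fun_apply tensor_apply)
  qed (simp add: tensor_mult_def sum_fun_apply tensor_def)
qed

section \<open>Homogeneous components\<close>

text \<open>\<open>hom_component\<close> is a definite description of the whole family of
  components, so everything is read off from unique existence: linearity holds because sums and
  multiples of decompositions are again decompositions.\<close>

lemma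
  fixes A :: "nat \<Rightarrow> 'a::ab_group_add set"
  assumes V: "vector_space s" and D: "direct_sum_decomposition s A"
  shows hom_component_mem: "hom_component A n x \<in> A n"
    and finite_hom_component: "finite {n. hom_component A n x \<noteq> 0}"
    and hom_component_sum: "(\<Sum>n | hom_component A n x \<noteq> 0. hom_component A n x) = x"
    and linear_hom_component: "Vector_Spaces.linear s s (hom_component A n)"
proof -
  interpret vector_space s by fact
  define P where "P x c \<longleftrightarrow> (\<forall>n. c n \<in> A n) \<and> finite {n. c n \<noteq> 0} \<and> x = (\<Sum>n | c n \<noteq> 0. c n)"
    for x and c :: "nat \<Rightarrow> 'a"
  have ex1: "\<exists>!c. P x c" for x
    using D unfolding direct_sum_decomposition_def P_def by blast
  have hc: "hom_component A n x = (THE c. P x c) n" for n x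
    by (simp add: hom_component_def P_def)
  have P: "P x (\<lambda>n. hom_component A n x)" for x
    using theI'[OF ex1[of x]] by (simp add: hc)
  have eq: "hom_component A n x = c n" if "P x c" for x c n
    using ex1[of x] P[of x] that by metis
  show "hom_component A n x \<in> A n" "finite {n. hom_component A n x \<noteq> 0}"
    "(\<Sum>n | hom_component A n x \<noteq> 0. hom_component A n x) = x"
    using P[of x] by (auto simp: P_def)
  have sub: "subspace (A n)" for n using D by (simp add: direct_sum_decomposition_def)
  \<comment> \<open>Any finite index set outside which \<open>c\<close> vanishes may be used, so
    that two decompositions can be added over a common one.\<close>
  have PI: "P x c" if "finite N" "\<And>n. n \<notin> N \<Longrightarrow> c n = 0" "\<And>n. c n \<in> A n" "x = (\<Sum>n\<in>N. c n)"
    for x c N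
  proof -
    have s: "{n. c n \<noteq> 0} \<subseteq> N" using that by blast
    then have "x = (\<Sum>n | c n \<noteq> 0. c n)"
      unfolding that(4) by (intro sum.mono_neutral_right that(1)) auto
    with s that show ?thesis unfolding P_def by (auto intro: finite_subset)
  qed
  have PD: "x = (\<Sum>n\<in>N. hom_component A n x)"
    if "finite N" "{n. hom_component A n x \<noteq> 0} \<subseteq> N" for x N
  proof -
    have "x = (\<Sum>n | hom_component A n x \<noteq> 0. hom_component A n x)" using P[of x] by (simp add: P_def)
    also have "\<dots> = (\<Sum>n\<in>N. hom_component A n x)"
      by (rule sum.mono_neutral_left) (use that in auto)
    finally show ?thesis .
  qed
  have fin: "finite {n. hom_component A n x \<noteq> 0}" for x using P[of x] by (simp add: P_def)
  show "Vector_Spaces.linear s s (hom_component A n)"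
  proof (rule linear_mapI[OF V V])
    fix x y
    let ?N = "{n. hom_component A n x \<noteq> 0} \<union> {n. hom_component A n y \<noteq> 0}"
    have "P (x + y) (\<lambda>n. hom_component A n x + hom_component A n y)"
    proof (rule PI[of ?N])
      show "x + y = (\<Sum>n\<in>?N. hom_component A n x + hom_component A n y)"
        using PD[of ?N x] PD[of ?N y] fin by (simp add: sum.distrib)
    qed (use fin P sub in \<open>auto simp: P_def intro: subspace_add\<close>)
    then show "hom_component A n (x + y) = hom_component A n x + hom_component A n y"
      by (rule eq)
  next
    fix k x
    let ?N = "{n. hom_component A n x \<noteq> 0}"
    have "P (s k x) (\<lambda>n. s k (hom_component A n x))"
    proof (rule PI[of ?N])
      show "s k x = (\<Sum>n\<in>?N. s k (hom_component A n x))"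
        using PD[of ?N x] fin by (simp flip: scale_sum_right)
    qed (use fin P sub in \<open>auto simp: P_def intro: subspace_scale\<close>)
    then show "hom_component A n (s k x) = s k (hom_component A n x)"
      by (rule eq)
  qed
qed

section \<open>Expansion in dual bases\<close>

text \<open>The \<open>q m\<close> are the coordinate functionals of the basis; in the applications
  they are pairings with the dual basis. The induction over the span carries along one finite index
  set containing the support.\<close>

lemma dual_basis_expansion:
  assumes V: "vector_space s" and basis: "is_basis s f"
    and add: "\<And>x y m. q m (x + y) = q m x + q m y" and scale: "\<And>k x m. q m (s k x) = k * q m x"
    and dual: "\<And>l m. q m (f l) = (if l = m then 1 else (0::'f::field))"
  shows "finite {m. q m x \<noteq> 0}"
    and "\<lbrakk>finite L; {m. q m x \<noteq> 0} \<subseteq> L\<rbrakk> \<Longrightarrow> (\<Sum>l\<in>L. s (q l x) (f l)) = x"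
proof -
  interpret vector_space s by fact
  have zero: "q m 0 = 0" for m using scale[of m 0 0] by simp
  have "x \<in> span (range f)" using basis by (simp add: is_basis_def)
  then have "\<exists>L. finite L \<and> {m. q m x \<noteq> 0} \<subseteq> L \<and> (\<Sum>l\<in>L. s (q l x) (f l)) = x"
  proof (induction rule: span_induct_alt)
    case base
    show ?case by (intro exI[of _ "{}"]) (simp add: zero)
  next
    case (step k y x)
    then obtain l L where y: "y = f l" and L: "finite L" "{m. q m x \<noteq> 0} \<subseteq> L"
      "(\<Sum>l\<in>L. s (q l x) (f l)) = x" by auto
    have "(\<Sum>l\<in>insert l L. s (q l x) (f l)) = x"
      using L by (cases "l \<in> L") (auto simp: insert_absorb)
    moreover have "(\<Sum>m\<in>insert l L. s (k * q m y) (f m)) = s k y"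
    proof -
      have "(\<Sum>m\<in>insert l L. s (k * q m y) (f m)) = (\<Sum>m\<in>{l}. s (k * q m y) (f m))"
        by (rule sum.mono_neutral_right) (use L in \<open>auto simp: y dual\<close>)
      then show ?thesis by (simp add: y dual)
    qed
    ultimately have "(\<Sum>m\<in>insert l L. s (q m (s k y + x)) (f m)) = s k y + x"
      by (simp only: add scale scale_left_distrib sum.distrib)
    moreover have "{m. q m (s k y + x) \<noteq> 0} \<subseteq> insert l L"
      using L(2) by (auto simp: add scale y dual split: if_splits)
    ultimately show ?case using L(1) by blast
  qed
  then obtain L where L: "finite L" "{m. q m x \<noteq> 0} \<subseteq> L" "(\<Sum>l\<in>L. s (q l x) (f l)) = x" by blast
  then show fin: "finite {m. q m x \<noteq> 0}" by (blast intro: finite_subset)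
  show "(\<Sum>l\<in>M. s (q l x) (f l)) = x" if M: "finite M" "{m. q m x \<noteq> 0} \<subseteq> M" for M
  proof -
    have eq: "(\<Sum>l\<in>N. s (q l x) (f l)) = (\<Sum>l | q l x \<noteq> 0. s (q l x) (f l))"
      if "finite N" "{m. q m x \<noteq> 0} \<subseteq> N" for N
      by (rule sum.mono_neutral_right) (use that in auto)
    show ?thesis using L(3) by (simp only: eq[OF M] eq[OF L(1,2)])
  qed
qed

section \<open>Coproducts of skew elements\<close>

context graded_connected_hopf_algebra
begin

lemma mult_scale: "s k x * y = s k (x * y)" "x * s k y = s k (x * y)"
  using bilinear_mapD[OF mult_bilinear] by (auto simp: Vector_Spaces.linear_iff)

lemma homogeneous_scale: "x \<in> A n \<Longrightarrow> s k x \<in> A n"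
  using grading by (auto simp: direct_sum_decomposition_def intro: subspace_scale)

lemma antipode_zero: "S 0 = 0"
  using antipode_linear unfolding Vector_Spaces.linear_iff by (metis scale_zero_left)

text \<open>The degrees of the two factors of each summand are kept as functions \<open>i\<close>
  and \<open>j\<close>, for the degree count in products of completed tensors.\<close>

lemma comult_homogeneousE:
  assumes "x \<in> A n"
  obtains U :: "('f, 'a, 'a) tensors set" and a b i j
  where "finite U" "\<Delta> x = (\<Sum>u\<in>U. tensor s s (a u) (b u))"
    "\<And>u. u \<in> U \<Longrightarrow> a u \<in> A (i u)" "\<And>u. u \<in> U \<Longrightarrow> b u \<in> A (j u)"
    "\<And>u. u \<in> U \<Longrightarrow> i u + j u = n"
proof (rule span_tensorE[OF vector_space_axioms vector_space_axioms, of "\<Delta> x"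
      "\<lambda>a b. \<exists>i j. i + j = n \<and> a \<in> A i \<and> b \<in> A j"])
  have "{tensor s s a b | a b i j. i + j = n \<and> a \<in> A i \<and> b \<in> A j} =
      {tensor s s a b | a b. \<exists>i j. i + j = n \<and> a \<in> A i \<and> b \<in> A j}" by auto
  then show "\<Delta> x \<in> module.span tscale {tensor s s a b | a b. \<exists>i j. i + j = n \<and> a \<in> A i \<and> b \<in> A j}"
    using comult_graded[OF assms] by (simp only: tensor_degree_def)
next
  fix U :: "('f, 'a, 'a) tensors set" and a b
  assume U: "finite U" "\<Delta> x = (\<Sum>u\<in>U. tensor s s (a u) (b u))"
    and "\<And>u. u \<in> U \<Longrightarrow> \<exists>i j. i + j = n \<and> a u \<in> A i \<and> b u \<in> A j"
  then have "\<forall>u\<in>U. \<exists>i j. i + j = n \<and> a u \<in> A i \<and> b u \<in> A j" by blast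
  then obtain i where "\<forall>u\<in>U. \<exists>j. i u + j = n \<and> a u \<in> A (i u) \<and> b u \<in> A j"
    by (rule bchoice[THEN exE])
  then obtain j where "\<forall>u\<in>U. i u + j u = n \<and> a u \<in> A (i u) \<and> b u \<in> A (j u)"
    by (rule bchoice[THEN exE])
  with U show thesis by (intro that[of U a b i j]) auto
qed (auto intro: homogeneous_scale)

text \<open>Coassociativity, with the third tensor factor paired with a coordinate functional.\<close>

lemma skew_comult:
  assumes basis: "is_basis s f"
    and lin: "\<And>t. Vector_Spaces.linear s (*) (q t)"
    and dual: "\<And>l t. q t (f l) = (if l = t then 1 else (0::'f))"
  shows "\<Delta> (skew s \<Delta> f e t) =
    (\<Sum>m | skew s \<Delta> f e m \<noteq> 0. tensor s s (skew s \<Delta> f e m) (skew s \<Delta> f m t))"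
proof
  fix B :: "'a \<Rightarrow> 'a \<Rightarrow> 'f"
  let ?h = "skew s \<Delta> f" let ?M = "{m. ?h e m \<noteq> 0}"
  note fin = skew_expansion(1)[OF basis] and exp = skew_expansion(2)[OF basis]
  show "\<Delta> (?h e t) B = (\<Sum>m\<in>?M. tensor s s (?h e m) (?h m t)) B"
  proof (cases "bilinear_map s s (*) B")
    case True
    note D = bilinear_formD[OF True]
    have q: "q t (x + y) = q t x + q t y" "q t (s k x) = k * q t x" for x y k
      using lin[of t] by (simp_all add: Vector_Spaces.linear_iff)
    have com: "\<Delta> (x + y) = \<Delta> x + \<Delta> y" "\<Delta> (s k x) = tscale k (\<Delta> x)" for x y k
      using comult_linear by (simp_all add: Vector_Spaces.linear_iff)
    have com0: "\<Delta> 0 = 0" using com(1)[of 0 0] by simp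
    have vs: "vector_space ((*) :: 'f \<Rightarrow> 'f \<Rightarrow> 'f)"
      by unfold_locales (auto simp: algebra_simps)
    \<comment> \<open>Coassociativity at \<open>f e\<close> is tested on this trilinear form. On the
      left, \<open>q t c\<close> picks out the coefficient of \<open>f t\<close> before
      \<open>B\<close> is evaluated; on the right, it turns the coproduct of each \<open>f m\<close>
      into \<open>skew s \<Delta> f m t\<close>.\<close>
    let ?T = "\<lambda>a b c. B a b * q t c"
    have tri: "trilinear_form s ?T"
      unfolding trilinear_form_def Vector_Spaces.linear_iff
      using vector_space_axioms vs by (auto simp: D q algebra_simps)
    have ac: "\<Delta> a (\<lambda>a' b. B a' b * q t c) = \<Delta> a B * q t c" for a c
    proof -
      have "\<Delta> a (\<lambda>a' b. \<Sum>i\<in>{()}. q t c * B a' b) = (\<Sum>i\<in>{()}. q t c * \<Delta> a B)"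
        by (rule tensor_space_apply_sum[OF vector_space_axioms vector_space_axioms comult_tensor])
          (simp_all add: True)
      then show ?thesis by (simp add: mult.commute)
    qed
    have bl: "bilinear_map s s (*) (\<lambda>a c. \<Delta> a B * q t c)"
      by (rule bilinear_formI[OF vector_space_axioms vector_space_axioms])
        (simp_all add: com q tscale_def algebra_simps)
    have br0: "bilinear_map s s (*) (\<lambda>b' c. B a b' * q t c)" for a
      by (rule bilinear_formI[OF vector_space_axioms vector_space_axioms])
        (simp_all add: D q algebra_simps)
    have scl: "\<Delta> b (\<lambda>b' c. k * C b' c) = k * \<Delta> b C" if "bilinear_map s s (*) C" for b k C
      using tensor_space_apply_sum[OF vector_space_axioms vector_space_axioms comult_tensor,
          of "{()}" "\<lambda>_. C" b "\<lambda>_. k"] that by simp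
    \<comment> \<open>With the two booleans as index set, linearity over finite sums becomes
      additivity; a one-element index set gave compatibility with scalars.\<close>
    have addl: "\<Delta> b (\<lambda>b' c. C b' c + C' b' c) = \<Delta> b C + \<Delta> b C'"
      if "bilinear_map s s (*) C" "bilinear_map s s (*) C'" for b C C'
      using tensor_space_apply_sum[OF vector_space_axioms vector_space_axioms comult_tensor,
          of UNIV "\<lambda>i. if i then C else C'" b "\<lambda>_. 1"] that by (simp add: UNIV_bool add.commute)
    have br: "bilinear_map s s (*) (\<lambda>a b. \<Delta> b (\<lambda>b' c. B a b' * q t c))"
    proof (rule bilinear_formI[OF vector_space_axioms vector_space_axioms])
      show "\<Delta> b (\<lambda>b' c. B (a + a') b' * q t c) =
          \<Delta> b (\<lambda>b' c. B a b' * q t c) + \<Delta> b (\<lambda>b' c. B a' b' * q t c)" for a a' b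
        by (simp add: D distrib_right addl[OF br0 br0])
      show "\<Delta> b (\<lambda>b' c. B (s k a) b' * q t c) = k * \<Delta> b (\<lambda>b' c. B a b' * q t c)" for k a b
        by (simp add: D mult.assoc scl[OF br0])
    qed (simp_all add: com tscale_def)
    have "comult_left s \<Delta> (\<Delta> (f e)) ?T = (\<Sum>m\<in>?M. \<Delta> (?h e m) B * q t (f m))"
      by (simp add: comult_left_def tri ac) (subst exp, simp only: sum_tensor_apply[OF bl])
    also have "\<dots> = (\<Sum>m\<in>?M. if m = t then \<Delta> (?h e m) B else 0)"
      by (rule sum.cong) (auto simp: dual)
    also have "\<dots> = \<Delta> (?h e t) B"
      using fin[of e] by (auto simp: sum.delta com0)
    finally have L: "comult_left s \<Delta> (\<Delta> (f e)) ?T = \<Delta> (?h e t) B" .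
    have R1: "\<Delta> (f m) (\<lambda>b' c. B a b' * q t c) = B a (?h m t)" for a m
    proof -
      have "\<Delta> (f m) (\<lambda>b' c. B a b' * q t c) = (\<Sum>k | ?h m k \<noteq> 0. B a (?h m k) * q t (f k))"
        by (subst exp) (rule sum_tensor_apply[OF br0])
      also have "\<dots> = (\<Sum>k | ?h m k \<noteq> 0. if k = t then B a (?h m k) else 0)"
        by (rule sum.cong) (auto simp: dual)
      also have "\<dots> = B a (?h m t)"
        using fin[of m] D(4)[of a 0 0] by (auto simp: sum.delta)
      finally show ?thesis .
    qed
    have "comult_right s \<Delta> (\<Delta> (f e)) ?T = (\<Sum>m\<in>?M. B (?h e m) (?h m t))"
      by (simp add: comult_right_def tri) (subst exp, simp only: sum_tensor_apply[OF br] R1)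
    then show ?thesis
      using L coassoc[of "f e"] by (simp add: sum_tensor_apply[OF True])
  next
    case False
    then show ?thesis
      using tensor_space_apply_nonbilinear[OF vector_space_axioms vector_space_axioms comult_tensor]
      by (simp add: sum_fun_apply tensor_def)
  qed
qed

text \<open>The counit axiom writes \<open>f e\<close> in the basis with coefficients
  \<open>\<epsilon> (skew s \<Delta> f e m)\<close>; applying \<open>q t\<close> compares
  coefficients.\<close>

lemma skew_counit:
  assumes basis: "is_basis s f"
    and lin: "\<And>t. Vector_Spaces.linear s (*) (q t)"
    and dual: "\<And>l t. q t (f l) = (if l = t then 1 else (0::'f))"
  shows "\<epsilon> (skew s \<Delta> f e t) = (if e = t then 1 else 0)"
proof -
  let ?h = "skew s \<Delta> f" let ?M = "{m. ?h e m \<noteq> 0}"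
  note fin = skew_expansion(1)[OF basis] and exp = skew_expansion(2)[OF basis]
  have cou: "\<epsilon> (x + y) = \<epsilon> x + \<epsilon> y" "\<epsilon> (s k x) = k * \<epsilon> x" for x y k
    using counit_linear by (simp_all add: Vector_Spaces.linear_iff)
  have b: "bilinear_map s s s (\<lambda>a b. s (\<epsilon> a) b)"
    unfolding bilinear_map_def Vector_Spaces.linear_iff
    using vector_space_axioms by (auto simp: cou algebra_simps)
  have "f e = (\<Sum>m\<in>?M. s (\<epsilon> (?h e m)) (f m))"
    using counit_left[of "f e"] exp[of e] tensor_lift_sum[OF b, of "?h e" f ?M] by metis
  then have "q t (f e) = q t (\<Sum>m\<in>?M. s (\<epsilon> (?h e m)) (f m))" by (rule arg_cong)
  also have "\<dots> = (\<Sum>m\<in>?M. q t (s (\<epsilon> (?h e m)) (f m)))"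
    using lin by (rule Vector_Spaces.linear.axioms(3)[THEN module_hom.sum])
  also have "\<dots> = (\<Sum>m\<in>?M. if m = t then \<epsilon> (?h e m) else 0)"
    using lin[of t] by (intro sum.cong) (auto simp: Vector_Spaces.linear_iff dual)
  also have "\<dots> = \<epsilon> (?h e t)"
    using fin[of e] cou(2)[of 0 0] by (auto simp: sum.delta)
  finally show ?thesis by (simp add: dual)
qed

text \<open>The antipode axiom at \<open>skew s \<Delta> f e t\<close>, with
  \<open>skew_comult\<close> for its coproduct and \<open>skew_counit\<close> for its counit. In
  matrix terms, the antipodes of the skew elements form a left inverse of the skew elements.\<close>

lemma skew_antipode:
  assumes basis: "is_basis s f"
    and lin: "\<And>t. Vector_Spaces.linear s (*) (q t)"
    and dual: "\<And>l t. q t (f l) = (if l = t then 1 else (0::'f))"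
  shows "(\<Sum>m | skew s \<Delta> f e m \<noteq> 0. S (skew s \<Delta> f e m) * skew s \<Delta> f m t) = (if e = t then 1 else 0)"
proof -
  have ant: "S (x + y) = S x + S y" "S (s k x) = s k (S x)" for x y k
    using antipode_linear by (simp_all add: Vector_Spaces.linear_iff)
  have b: "bilinear_map s s s (\<lambda>a b. S a * b)"
    unfolding bilinear_map_def Vector_Spaces.linear_iff
    using vector_space_axioms by (auto simp: ant mult_scale algebra_simps)
  show ?thesis
    using antipode_left[of "skew s \<Delta> f e t"] skew_counit[OF assms, of e t]
    unfolding skew_comult[OF assms] tensor_lift_sum[OF b] by auto
qed

end

section \<open>Dual pairs of graded Hopf algebras\<close>

text \<open>\<open>K\<close> is the dual Hopf algebra H^vee of the theorem, and \<open>p\<close> its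
  pairing with \<open>H\<close>.\<close>

locale dual_hopf_pair =
  H: graded_connected_hopf_algebra s\<^sub>H H \<Delta>\<^sub>H \<epsilon>\<^sub>H S\<^sub>H + K: graded_connected_hopf_algebra s\<^sub>K K \<Delta>\<^sub>K \<epsilon>\<^sub>K S\<^sub>K
  for s\<^sub>H :: "'f::field \<Rightarrow> 'a::ring_1 \<Rightarrow> 'a" and H \<Delta>\<^sub>H \<epsilon>\<^sub>H S\<^sub>H
    and s\<^sub>K :: "'f \<Rightarrow> 'b::ring_1 \<Rightarrow> 'b" and K \<Delta>\<^sub>K \<epsilon>\<^sub>K S\<^sub>K +
  fixes p :: "'a \<Rightarrow> 'b \<Rightarrow> 'f" and f :: "'i \<Rightarrow> 'a" and g :: "'i \<Rightarrow> 'b"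
  assumes finite_pieces: "finite_dimensional_pieces s\<^sub>H H"
    and pairing: "graded_nondegenerate_hopf_pairing s\<^sub>H H \<Delta>\<^sub>H s\<^sub>K K \<Delta>\<^sub>K p"
    and dual_bases: "homogeneous_dual_bases s\<^sub>H H s\<^sub>K K p f g"
begin

abbreviation "fs \<equiv> skew s\<^sub>H \<Delta>\<^sub>H f"
abbreviation "gs \<equiv> skew s\<^sub>K \<Delta>\<^sub>K g"
abbreviation "T a b \<equiv> completed s\<^sub>H H s\<^sub>K K (tensor s\<^sub>H s\<^sub>K a b)"

subsection \<open>The pairing and the bases\<close>

lemma pairing_bilinear: "bilinear_map s\<^sub>H s\<^sub>K (*) p"
  using pairing by (simp add: graded_nondegenerate_hopf_pairing_def)

lemmas pairing_simps [simp] = bilinear_formD[OF pairing_bilinear]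

lemma pairing_zero [simp]: "p 0 c = 0" "p a 0 = 0"
  using pairing_simps(2)[of 0 0 c] pairing_simps(4)[of a 0 0] by simp_all

lemma pairing_sum:
  "p (\<Sum>i\<in>I. x i) c = (\<Sum>i\<in>I. p (x i) c)" "p a (\<Sum>i\<in>I. y i) = (\<Sum>i\<in>I. p a (y i))"
  by (induction I rule: infinite_finite_induct) simp_all

lemma pairing_orthogonal: "a \<in> H i \<Longrightarrow> c \<in> K j \<Longrightarrow> i \<noteq> j \<Longrightarrow> p a c = 0"
  using pairing unfolding graded_nondegenerate_hopf_pairing_def by blast

lemma pairing_linear: "Vector_Spaces.linear s\<^sub>K (*) (p a)" "Vector_Spaces.linear s\<^sub>H (*) (\<lambda>a. p a c)"
  using bilinear_mapD[OF pairing_bilinear] by simp_all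

text \<open>Tensors vanish off bilinear forms, so a form must be known to be bilinear before a
  tensor is evaluated at it. Forms of the third kind are the tests for equality in the
  completion.\<close>

lemma pairing_product_bilinear:
  "bilinear_map s\<^sub>H s\<^sub>H (*) (\<lambda>a b. p a c * p b d)"
  "bilinear_map s\<^sub>K s\<^sub>K (*) (\<lambda>c d. p a c * p e d)"
  "bilinear_map s\<^sub>H s\<^sub>K (*) (\<lambda>a b. p a c * p e b)"
proof -
  note H = H.vector_space_axioms and K = K.vector_space_axioms
  show "bilinear_map s\<^sub>H s\<^sub>H (*) (\<lambda>a b. p a c * p b d)"
    by (rule bilinear_formI[OF H H]) (simp_all add: algebra_simps)
  show "bilinear_map s\<^sub>K s\<^sub>K (*) (\<lambda>c d. p a c * p e d)"
    by (rule bilinear_formI[OF K K]) (simp_all add: algebra_simps)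
  show "bilinear_map s\<^sub>H s\<^sub>K (*) (\<lambda>a b. p a c * p e b)"
    by (rule bilinear_formI[OF H K]) (simp_all add: algebra_simps)
qed

lemma pairing_mult_left:
  assumes "\<Delta>\<^sub>K c = (\<Sum>u\<in>U. tensor s\<^sub>K s\<^sub>K (x u) (y u))"
  shows "p (a * b) c = (\<Sum>u\<in>U. p a (x u) * p b (y u))"
proof -
  have b: "bilinear_map s\<^sub>H s\<^sub>H (*) (\<lambda>a b. \<Sum>u\<in>U. p a (x u) * p b (y u))"
    by (rule bilinear_formI[OF H.vector_space_axioms H.vector_space_axioms])
      (simp_all add: algebra_simps sum.distrib sum_distrib_left)
  have "p (a * b) c = tensor_pairing p p (tensor s\<^sub>H s\<^sub>H a b) (\<Delta>\<^sub>K c)"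
    using pairing by (simp add: graded_nondegenerate_hopf_pairing_def)
  also have "\<dots> = (\<Sum>u\<in>U. p a (x u) * p b (y u))"
    by (simp add: tensor_pairing_def assms sum_tensor_apply[OF pairing_product_bilinear(2)] tensor_apply[OF b])
  finally show ?thesis .
qed

lemma pairing_mult_right:
  assumes "\<Delta>\<^sub>H a = (\<Sum>u\<in>U. tensor s\<^sub>H s\<^sub>H (x u) (y u))"
  shows "p a (b * c) = (\<Sum>u\<in>U. p (x u) b * p (y u) c)"
proof -
  have "p a (b * c) = tensor_pairing p p (\<Delta>\<^sub>H a) (tensor s\<^sub>K s\<^sub>K b c)"
    using pairing by (simp add: graded_nondegenerate_hopf_pairing_def)
  also have "\<dots> = (\<Sum>u\<in>U. p (x u) b * p (y u) c)"
    by (simp add: tensor_pairing_def assms tensor_apply[OF pairing_product_bilinear(2)]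
        sum_tensor_apply[OF pairing_product_bilinear(1)])
  finally show ?thesis .
qed

lemma bases: "is_basis s\<^sub>H f" "is_basis s\<^sub>K g"
  and dual [simp]: "p (f l) (g m) = (if l = m then 1 else 0)"
  using dual_bases by (simp_all add: homogeneous_dual_bases_def)

lemma homogeneousE:
  obtains n where "f l \<in> H n" "g l \<in> K n"
  using dual_bases unfolding homogeneous_dual_bases_def by blast

lemma finite_support: "finite {l. p a (g l) \<noteq> 0}" "finite {l. p (f l) c \<noteq> 0}"
proof -
  show "finite {l. p a (g l) \<noteq> 0}"
    by (rule dual_basis_expansion(1)[OF H.vector_space_axioms bases(1), of "\<lambda>l a. p a (g l)"])
      simp_all
  show "finite {l. p (f l) c \<noteq> 0}"
    by (rule dual_basis_expansion(1)[OF K.vector_space_axioms bases(2), of "\<lambda>l. p (f l)"])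
      simp_all
qed

lemma expansion_H:
  assumes "finite L" "{l. p a (g l) \<noteq> 0} \<subseteq> L"
  shows "(\<Sum>l\<in>L. s\<^sub>H (p a (g l)) (f l)) = a"
  by (rule dual_basis_expansion(2)[OF H.vector_space_axioms bases(1), of "\<lambda>l a. p a (g l)"])
    (simp_all add: assms)

lemma expansion_K:
  assumes "finite L" "{l. p (f l) c \<noteq> 0} \<subseteq> L"
  shows "(\<Sum>l\<in>L. s\<^sub>K (p (f l) c) (g l)) = c"
  by (rule dual_basis_expansion(2)[OF K.vector_space_axioms bases(2), of "\<lambda>l. p (f l)"])
    (simp_all add: assms)

text \<open>The dual basis expansion of \<open>c\<close>, paired with \<open>d\<close>; this is why
  the canonical element represents the pairing itself.\<close>

lemma pairing_expansion:
  assumes "finite L" "{l. p (f l) c \<noteq> 0} \<subseteq> L"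
  shows "(\<Sum>l\<in>L. p (f l) c * p d (g l)) = p d c"
  using arg_cong[OF expansion_K[OF assms], of "p d"] by (simp add: pairing_sum)

lemma finite_support_skew: "finite {t. fs l t \<noteq> 0}" "finite {t. gs l t \<noteq> 0}"
  using H.skew_expansion(1)[OF bases(1)] K.skew_expansion(1)[OF bases(2)] by blast+

section \<open>Pairing with skew elements\<close>

text \<open>Pairing the second factor of \<open>\<Delta>\<^sub>H (f l)\<close> with
  \<open>g t\<close> selects the coefficient of \<open>f t\<close> by duality, so skewing by
  \<open>t\<close> is adjoint to right multiplication by \<open>g t\<close>.\<close>

lemma pairing_skew_left: "p (fs l t) c = p (f l) (c * g t)"
proof -
  have "p (f l) (c * g t) = (\<Sum>m | fs l m \<noteq> 0. p (fs l m) c * p (f m) (g t))"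
    by (rule pairing_mult_right[OF H.skew_expansion(2)[OF bases(1)]])
  also have "\<dots> = (\<Sum>m | fs l m \<noteq> 0. if m = t then p (fs l m) c else 0)"
    by (rule sum.cong) auto
  also have "\<dots> = p (fs l t) c" using finite_support_skew(1) by (auto simp: sum.delta)
  finally show ?thesis by simp
qed

lemma pairing_skew_right: "p d (gs l t) = p (d * f t) (g l)"
proof -
  have "p (d * f t) (g l) = (\<Sum>m | gs l m \<noteq> 0. p d (gs l m) * p (f t) (g m))"
    by (rule pairing_mult_left[OF K.skew_expansion(2)[OF bases(2)]])
  also have "\<dots> = (\<Sum>m | gs l m \<noteq> 0. if m = t then p d (gs l m) else 0)"
    by (rule sum.cong) auto
  also have "\<dots> = p d (gs l t)" using finite_support_skew(2) by (auto simp: sum.delta)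
  finally show ?thesis by simp
qed

text \<open>Multiplicativity of \<open>\<Delta>\<^sub>K\<close> splits \<open>c * g m\<close>;
  pairing \<open>f l\<close> with the second factors \<open>y u * g t\<close> then produces
  \<open>fs l t\<close>.\<close>

lemma pairing_skew_mult:
  assumes "\<Delta>\<^sub>K c = (\<Sum>u\<in>U. tensor s\<^sub>K s\<^sub>K (x u) (y u))"
  shows "p (d * f l) (c * g m) = (\<Sum>u\<in>U. \<Sum>t | fs l t \<noteq> 0. p d (x u * gs m t) * p (fs l t) (y u))"
proof -
  let ?M = "{t. gs m t \<noteq> 0}" and ?L = "{t. fs l t \<noteq> 0}"
  have "\<Delta>\<^sub>K (c * g m) = (\<Sum>u\<in>U. \<Sum>t\<in>?M. tensor s\<^sub>K s\<^sub>K (x u * gs m t) (y u * g t))"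
    unfolding K.comult_mult assms K.skew_expansion(2)[OF bases(2), of m]
    by (rule tensor_mult_sum[OF K.mult_bilinear K.mult_bilinear])
  then have "\<Delta>\<^sub>K (c * g m) = (\<Sum>v\<in>U \<times> ?M. tensor s\<^sub>K s\<^sub>K (x (fst v) * gs m (snd v)) (y (fst v) * g (snd v)))"
    by (simp add: sum.cartesian_product split_def)
  from pairing_mult_left[OF this, of d "f l"]
  have "p (d * f l) (c * g m) = (\<Sum>u\<in>U. \<Sum>t\<in>?M. p d (x u * gs m t) * p (fs l t) (y u))"
    by (simp add: sum.cartesian_product split_def pairing_skew_left)
  \<comment> \<open>A nonzero term needs both \<open>gs m t\<close> and \<open>fs l t\<close>
    nonzero, so either support may index the sum. The support of \<open>fs l\<close> does not depend
    on \<open>m\<close>, which permits summing over \<open>m\<close> later.\<close>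
  also have "\<dots> = (\<Sum>u\<in>U. \<Sum>t\<in>?L. p d (x u * gs m t) * p (fs l t) (y u))"
  proof (rule sum.cong)
    fix u
    have "(\<Sum>t\<in>N. p d (x u * gs m t) * p (fs l t) (y u)) =
        (\<Sum>t\<in>?M \<union> ?L. p d (x u * gs m t) * p (fs l t) (y u))" if "N = ?M \<or> N = ?L" for N
      by (rule sum.mono_neutral_left) (use that finite_support_skew in auto)
    then show "(\<Sum>t\<in>?M. p d (x u * gs m t) * p (fs l t) (y u)) =
        (\<Sum>t\<in>?L. p d (x u * gs m t) * p (fs l t) (y u))" by simp
  qed simp
  finally show ?thesis .
qed

section \<open>Degrees and the pairing\<close>

lemma pairing_hom_component_left:
  assumes c: "c \<in> K j"
  shows "p (hom_component H k a) c = (if k = j then p a c else 0)"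
proof -
  note H = H.vector_space_axioms H.grading
  have k: "p (hom_component H k a) c = 0" if "k \<noteq> j" for k
    using hom_component_mem[OF H] c that by (rule pairing_orthogonal)
  have "p a c = (\<Sum>n | hom_component H n a \<noteq> 0. p (hom_component H n a) c)"
    using arg_cong[OF hom_component_sum[OF H, of a], of "\<lambda>a. p a c"] by (simp add: pairing_sum)
  also have "\<dots> = (\<Sum>n | hom_component H n a \<noteq> 0. if n = j then p (hom_component H n a) c else 0)"
    by (rule sum.cong) (auto simp: k)
  also have "\<dots> = p (hom_component H j a) c"
    using finite_hom_component[OF H, of a] by (auto simp: sum.delta)
  finally show ?thesis using k by simp
qed

lemma pairing_hom_component_right:
  assumes d: "d \<in> H j"
  shows "p d (hom_component K k b) = (if k = j then p d b else 0)"
proof -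
  note K = K.vector_space_axioms K.grading
  have k: "p d (hom_component K k b) = 0" if "k \<noteq> j" for k
    using d hom_component_mem[OF K] that[symmetric] by (rule pairing_orthogonal)
  have "p d b = (\<Sum>n | hom_component K n b \<noteq> 0. p d (hom_component K n b))"
    using arg_cong[OF hom_component_sum[OF K, of b], of "p d"] by (simp add: pairing_sum)
  also have "\<dots> = (\<Sum>n | hom_component K n b \<noteq> 0. if n = j then p d (hom_component K n b) else 0)"
    by (rule sum.cong) (auto simp: k)
  also have "\<dots> = p d (hom_component K j b)"
    using finite_hom_component[OF K, of b] by (auto simp: sum.delta)
  finally show ?thesis using k by simp
qed

text \<open>The basis elements of one degree are independent in a space spanned by finitely many
  vectors. Degreewise finiteness of sums over the whole basis rests on this bound.\<close>

lemma finite_bounded_degree: "finite {l. \<exists>n\<le>N. f l \<in> H n}"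
proof -
  have "finite {l. f l \<in> H n}" for n
  proof -
    obtain X where X: "finite X" "H n = H.span X"
      using finite_pieces[unfolded finite_dimensional_pieces_def, THEN spec, of n]
      by (elim exE conjE) (rule that)
    have "\<not> H.dependent (range f)" using bases(1) by (simp add: is_basis_def)
    then have "\<not> H.dependent (f ` {l. f l \<in> H n})"
      by (rule H.independent_mono) auto
    then have "finite (f ` {l. f l \<in> H n})"
      using H.independent_span_bound[OF X(1), of "f ` {l. f l \<in> H n}"] X(2) by auto
    then show ?thesis
      using bases(1) by (elim finite_imageD) (auto simp: is_basis_def intro: inj_on_subset)
  qed
  then have "finite (\<Union>n\<le>N. {l. f l \<in> H n})" by simp
  then show ?thesis by (rule rev_finite_subset) auto
qed

subsection \<open>Elements of the completion as bilinear forms on the dual side\<close>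

text \<open>Expanding both factors of each summand in the dual bases reduces the value at
  \<open>B\<close> to values at pairing forms. The claim covers all large finite \<open>M\<close>,
  so that two tensors can be compared over a common index set.\<close>

lemma tensor_value_expansion:
  assumes t: "t \<in> tensor_space s\<^sub>H s\<^sub>K" and B: "bilinear_map s\<^sub>H s\<^sub>K (*) B"
  shows "\<exists>N. finite N \<and> (\<forall>M. finite M \<longrightarrow> N \<subseteq> M \<longrightarrow>
    t B = (\<Sum>l\<in>M. \<Sum>m\<in>M. B (f l) (g m) * t (\<lambda>a b. p a (g l) * p (f m) b)))"
proof -
  obtain U :: "('f, 'a, 'b) tensors set" and a b
    where U: "finite U" "t = (\<Sum>u\<in>U. tensor s\<^sub>H s\<^sub>K (a u) (b u))"
    using H.vector_space_axioms K.vector_space_axioms t by (rule tensor_spaceE)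
  note D = bilinear_formD[OF B]
  have B0: "B 0 y = 0" "B x 0 = 0" for x y using D(2)[of 0 0 y] D(4)[of x 0 0] by simp_all
  have Bs: "B (\<Sum>i\<in>I. x i) y = (\<Sum>i\<in>I. B (x i) y)" "B z (\<Sum>i\<in>I. w i) = (\<Sum>i\<in>I. B z (w i))"
    for I :: "'i set" and x y z w
    by (induction I rule: infinite_finite_induct) (simp_all add: D B0)
  let ?N = "(\<Union>u\<in>U. {l. p (a u) (g l) \<noteq> 0} \<union> {l. p (f l) (b u) \<noteq> 0})"
  show ?thesis
  proof (intro exI[of _ ?N] conjI allI impI)
    show "finite ?N" using U(1) finite_support by blast
    fix M assume M: "finite M" "?N \<subseteq> M"
    have "B (a u) (b u) = (\<Sum>l\<in>M. \<Sum>m\<in>M. B (f l) (g m) * (p (a u) (g l) * p (f m) (b u)))"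
      if u: "u \<in> U" for u
    proof -
      have a: "a u = (\<Sum>l\<in>M. s\<^sub>H (p (a u) (g l)) (f l))"
        by (rule expansion_H[symmetric]) (use M u in auto)
      have b: "b u = (\<Sum>l\<in>M. s\<^sub>K (p (f l) (b u)) (g l))"
        by (rule expansion_K[symmetric]) (use M u in auto)
      have "B (a u) (b u) = B (\<Sum>l\<in>M. s\<^sub>H (p (a u) (g l)) (f l)) (\<Sum>l\<in>M. s\<^sub>K (p (f l) (b u)) (g l))"
        using a b by (rule arg_cong2)
      also have "\<dots> = (\<Sum>l\<in>M. \<Sum>m\<in>M. B (f l) (g m) * (p (a u) (g l) * p (f m) (b u)))"
        by (simp only: Bs(1)) (simp add: Bs(2) D sum_distrib_left mult_ac)
      finally show ?thesis .
    qed
    then have "t B = (\<Sum>u\<in>U. \<Sum>l\<in>M. \<Sum>m\<in>M. B (f l) (g m) * (p (a u) (g l) * p (f m) (b u)))"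
      by (simp add: U(2) sum_tensor_apply[OF B])
    also have "\<dots> = (\<Sum>l\<in>M. \<Sum>u\<in>U. \<Sum>m\<in>M. B (f l) (g m) * (p (a u) (g l) * p (f m) (b u)))"
      by (rule sum.swap)
    also have "\<dots> = (\<Sum>l\<in>M. \<Sum>m\<in>M. \<Sum>u\<in>U. B (f l) (g m) * (p (a u) (g l) * p (f m) (b u)))"
      by (intro sum.cong refl sum.swap)
    also have "\<dots> = (\<Sum>l\<in>M. \<Sum>m\<in>M. B (f l) (g m) * t (\<lambda>a b. p a (g l) * p (f m) b))"
      by (simp add: U(2) sum_tensor_apply[OF pairing_product_bilinear(3)] sum_distrib_left)
    finally show "t B = \<dots>" .
  qed
qed

text \<open>The values at the homogeneous elements \<open>g l\<close> and \<open>f m\<close>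
  determine a tensor on bilinear forms; elsewhere both tensors vanish.\<close>

lemma tensor_eqI:
  assumes t: "t \<in> tensor_space s\<^sub>H s\<^sub>K" and u: "u \<in> tensor_space s\<^sub>H s\<^sub>K"
    and eq: "\<And>i j c d. c \<in> K i \<Longrightarrow> d \<in> H j \<Longrightarrow> t (\<lambda>a b. p a c * p d b) = u (\<lambda>a b. p a c * p d b)"
  shows "t = u"
proof
  fix B
  show "t B = u B"
  proof (cases "bilinear_map s\<^sub>H s\<^sub>K (*) B")
    case B: True
    obtain N where N: "finite N" "\<And>M. finite M \<Longrightarrow> N \<subseteq> M \<Longrightarrow>
      t B = (\<Sum>l\<in>M. \<Sum>m\<in>M. B (f l) (g m) * t (\<lambda>a b. p a (g l) * p (f m) b))"
      using tensor_value_expansion[OF t B] by (elim exE conjE) (simp add: that)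
    obtain N' where N': "finite N'" "\<And>M. finite M \<Longrightarrow> N' \<subseteq> M \<Longrightarrow>
      u B = (\<Sum>l\<in>M. \<Sum>m\<in>M. B (f l) (g m) * u (\<lambda>a b. p a (g l) * p (f m) b))"
      using tensor_value_expansion[OF u B] by (elim exE conjE) (simp add: that)
    have "t (\<lambda>a b. p a (g l) * p (f m) b) = u (\<lambda>a b. p a (g l) * p (f m) b)" for l m
      by (rule homogeneousE[of l], rule homogeneousE[of m]) (rule eq)
    then show ?thesis
      using N(2)[of "N \<union> N'"] N'(2)[of "N \<union> N'"] N(1) N'(1) by simp
  next
    case False
    then show ?thesis
      using tensor_space_apply_nonbilinear[OF H.vector_space_axioms K.vector_space_axioms] t u by metis
  qed
qed

text \<open>
  An element of the completion is determined by its values on \<open>K\<^sub>i \<otimes> H\<^sub>j\<close>, where \<open>c \<otimes> d\<close> is paired with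
  the component of degree \<open>i + j\<close>. The values of \<open>\<xi>\<close> at inhomogeneous arguments are irrelevant.
\<close>

definition represents :: "('f, 'a, 'b) completion \<Rightarrow> ('b \<Rightarrow> 'a \<Rightarrow> 'f) \<Rightarrow> bool" where
  "represents X \<xi> \<longleftrightarrow> (\<forall>n. X n \<in> tensor_space s\<^sub>H s\<^sub>K \<and>
     (\<forall>i j. \<forall>c\<in>K i. \<forall>d\<in>H j. X n (\<lambda>a b. p a c * p d b) = (if n = i + j then \<xi> c d else 0)))"

lemma representsI:
  assumes "\<And>n. X n \<in> tensor_space s\<^sub>H s\<^sub>K"
    and "\<And>n i j c d. c \<in> K i \<Longrightarrow> d \<in> H j \<Longrightarrow>
      X n (\<lambda>a b. p a c * p d b) = (if n = i + j then \<xi> c d else 0)"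
  shows "represents X \<xi>"
  using assms unfolding represents_def by blast

lemma representsD:
  assumes "represents X \<xi>"
  shows "X n \<in> tensor_space s\<^sub>H s\<^sub>K"
    and "c \<in> K i \<Longrightarrow> d \<in> H j \<Longrightarrow> X n (\<lambda>a b. p a c * p d b) = (if n = i + j then \<xi> c d else 0)"
  using assms unfolding represents_def by blast+

lemma represents_unique:
  assumes "represents X \<xi>" "represents Y \<xi>"
  shows "X = Y"
proof
  show "X n = Y n" for n
    by (rule tensor_eqI) (simp_all add: representsD[OF assms(1)] representsD[OF assms(2)])
qed

section \<open>Pure tensors in the completion\<close>

lemma completed_tensor:
  "T a b n = (\<Sum>k\<le>n. tensor s\<^sub>H s\<^sub>K (hom_component H k a) (hom_component K (n - k) b))"
  by (simp add: completed_def tensor_map_tensor[OF linear_hom_component[OF H.vector_space_axioms H.grading]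
        linear_hom_component[OF K.vector_space_axioms K.grading]])

lemma represents_completed: "represents (T a b) (\<lambda>c d. p a c * p d b)"
proof (rule representsI)
  show "T a b n \<in> tensor_space s\<^sub>H s\<^sub>K" for n
    unfolding completed_tensor by (intro tensor_space_sum tensor_space_tensor)
  fix n i j c d assume c: "c \<in> K i" and d: "d \<in> H j"
  have "T a b n (\<lambda>a b. p a c * p d b) =
      (\<Sum>k\<le>n. p (hom_component H k a) c * p d (hom_component K (n - k) b))"
    unfolding completed_tensor by (rule sum_tensor_apply[OF pairing_product_bilinear(3)])
  \<comment> \<open>The first pairing forces \<open>k = i\<close>, the second
    \<open>n - k = j\<close>; as \<open>k \<le> n\<close>, together they say
    \<open>n = i + j\<close>.\<close>
  also have "\<dots> = (\<Sum>k\<le>n. if k = i then (if n = i + j then p a c * p d b else 0) else 0)"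
    by (rule sum.cong) (auto simp: pairing_hom_component_left[OF c] pairing_hom_component_right[OF d])
  also have "\<dots> = (if n = i + j then p a c * p d b else 0)"
    by (auto simp: sum.delta)
  finally show "T a b n (\<lambda>a b. p a c * p d b) = (if n = i + j then p a c * p d b else 0)" .
qed

text \<open>Contrapositive of \<open>tensor_eqI\<close> against 0: in degree \<open>n\<close> only
  test elements with \<open>n = i + j\<close> count, hence \<open>i \<le> n\<close>.\<close>

lemma completed_nonzeroE:
  assumes "T a b n \<noteq> 0"
  obtains i c where "i \<le> n" "c \<in> K i" "p a c \<noteq> 0"
proof -
  have "T a b n = 0" if z: "\<And>i c. i \<le> n \<Longrightarrow> c \<in> K i \<Longrightarrow> p a c = 0"
  proof (rule tensor_eqI)
    have "(\<Sum>i\<in>{}. 0) \<in> tensor_space s\<^sub>H s\<^sub>K" by (rule tensor_space_sum) simp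
    then show "0 \<in> tensor_space s\<^sub>H s\<^sub>K" by simp
    show "T a b n (\<lambda>a b. p a c * p d b) = 0 (\<lambda>a b. p a c * p d b)"
      if "c \<in> K i" "d \<in> H j" for i j c d
      using representsD(2)[OF represents_completed that] z[of i c] that by simp
  qed (rule representsD(1)[OF represents_completed])
  with assms that show thesis by blast
qed

text \<open>A nonzero component in degree \<open>n\<close> needs some \<open>c\<close> of degree at
  most \<open>n\<close> with \<open>p (f r) (c * g m)\<close> nonzero, which bounds the degree of
  \<open>f r\<close>. As \<open>b\<close> is arbitrary, the bound serves both identities.\<close>

lemma finite_completed_skew: "finite {r. T (fs r m) (b r) n \<noteq> 0}"
proof -
  obtain k where k: "g m \<in> K k" by (rule homogeneousE)
  have "\<exists>n'\<le>n + k. f r \<in> H n'" if nz: "T (fs r m) (b r) n \<noteq> 0" for r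
  proof -
    obtain i c where c: "i \<le> n" "c \<in> K i" "p (fs r m) c \<noteq> 0"
      using nz by (rule completed_nonzeroE)
    obtain n' where n': "f r \<in> H n'" by (rule homogeneousE)
    have "n' = i + k"
      using c(3) pairing_orthogonal[OF n' K.mult_graded[OF c(2) k]] by (auto simp: pairing_skew_left)
    with c(1) n' show ?thesis by (intro exI[of _ n']) simp
  qed
  then show ?thesis by (intro finite_subset[OF _ finite_bounded_degree[of "n + k"]]) blast
qed

lemma completed_zero: "T 0 b n = 0" "T a 0 n = 0"
proof -
  show "T 0 b n = 0" by (rule ccontr) (auto elim!: completed_nonzeroE)
  \<comment> \<open>\<open>completed_nonzeroE\<close> speaks of the first factor only, so a zero
    second factor is handled by comparison with \<open>T 0 0\<close>, which represents the same zero
    form.\<close>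
  have "represents (T a 0) (\<lambda>c d. 0)" using represents_completed[of a 0] by simp
  moreover have "represents (T 0 0) (\<lambda>c d. 0)" using represents_completed[of 0 0] by simp
  ultimately have "T a 0 = T 0 0" by (rule represents_unique)
  moreover have "T 0 0 n = 0" by (rule ccontr) (auto elim!: completed_nonzeroE)
  ultimately show "T a 0 n = 0" by simp
qed

section \<open>Sums and products in the completion\<close>

text \<open>For \<open>n = i + j\<close>, a nonzero value comes from a nonzero component, so the
  indices counted by \<open>completion_sum\<close> cover the support of the values. The finite set
  \<open>J\<close> may depend on \<open>c\<close> and \<open>d\<close>.\<close>

lemma represents_completion_sum:
  assumes fin: "degreewise_finite x"
    and x: "\<And>r. represents (x r) (\<xi> r)"
    and sum: "\<And>i j c d. c \<in> K i \<Longrightarrow> d \<in> H j \<Longrightarrow>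
      \<exists>J. finite J \<and> {r. \<xi> r c d \<noteq> 0} \<subseteq> J \<and> (\<Sum>r\<in>J. \<xi> r c d) = \<zeta> c d"
  shows "represents (completion_sum x) \<zeta>"
proof (rule representsI)
  show "completion_sum x n \<in> tensor_space s\<^sub>H s\<^sub>K" for n
    unfolding completion_sum_def by (intro tensor_space_sum representsD(1)[OF x])
  fix n i j c d assume cd: "c \<in> K i" "d \<in> H j"
  have v: "completion_sum x n (\<lambda>a b. p a c * p d b) =
      (\<Sum>r | x r n \<noteq> 0. if n = i + j then \<xi> r c d else 0)"
    by (simp add: completion_sum_def sum_fun_apply representsD(2)[OF x cd])
  show "completion_sum x n (\<lambda>a b. p a c * p d b) = (if n = i + j then \<zeta> c d else 0)"
  proof (cases "n = i + j")
    case True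
    obtain J where J: "finite J" "{r. \<xi> r c d \<noteq> 0} \<subseteq> J" "(\<Sum>r\<in>J. \<xi> r c d) = \<zeta> c d"
      using sum[OF cd] by blast
    have "{r. \<xi> r c d \<noteq> 0} \<subseteq> {r. x r n \<noteq> 0}"
    proof clarify
      fix r assume "\<xi> r c d \<noteq> 0" "x r n = 0"
      then show False using representsD(2)[OF x cd, of r n] True by simp
    qed
    then have "(\<Sum>r | x r n \<noteq> 0. \<xi> r c d) = (\<Sum>r | \<xi> r c d \<noteq> 0. \<xi> r c d)"
      using fin by (intro sum.mono_neutral_right) (auto simp: degreewise_finite_def)
    also have "\<dots> = (\<Sum>r\<in>J. \<xi> r c d)"
      using J(1,2) by (intro sum.mono_neutral_left) auto
    finally show ?thesis using True v J(3) by simp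
  qed (simp add: v)
qed

text \<open>The pairing turns products into coproducts, so a product represents the convolution of
  the two forms. \<open>val\<close> is required for all expansions of the coproducts because the
  proof chooses its own.\<close>

lemma represents_completion_mult:
  assumes X: "represents X \<xi>" and Y: "represents Y \<eta>"
    and val: "\<And>i j c d (U :: ('f, 'b, 'b) tensors set) x y (V :: ('f, 'a, 'a) tensors set) z w. c \<in> K i \<Longrightarrow> d \<in> H j \<Longrightarrow>
      \<Delta>\<^sub>K c = (\<Sum>u\<in>U. tensor s\<^sub>K s\<^sub>K (x u) (y u)) \<Longrightarrow> \<Delta>\<^sub>H d = (\<Sum>v\<in>V. tensor s\<^sub>H s\<^sub>H (z v) (w v)) \<Longrightarrow>
      (\<Sum>u\<in>U. \<Sum>v\<in>V. \<xi> (x u) (z v) * \<eta> (y u) (w v)) = \<zeta> c d"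
  shows "represents (completion_mult s\<^sub>H s\<^sub>K X Y) \<zeta>"
proof (rule representsI)
  note vs = H.vector_space_axioms K.vector_space_axioms
  show "completion_mult s\<^sub>H s\<^sub>K X Y n \<in> tensor_space s\<^sub>H s\<^sub>K" for n
    unfolding completion_mult_def
  proof (rule tensor_space_sum)
    fix k
    obtain U :: "('f, 'a, 'b) tensors set" and a b
      where U: "finite U" "X k = (\<Sum>u\<in>U. tensor s\<^sub>H s\<^sub>K (a u) (b u))"
      using vs representsD(1)[OF X] by (rule tensor_spaceE)
    obtain V :: "('f, 'a, 'b) tensors set" and a' b'
      where V: "finite V" "Y (n - k) = (\<Sum>u\<in>V. tensor s\<^sub>H s\<^sub>K (a' u) (b' u))"
      using vs representsD(1)[OF Y] by (rule tensor_spaceE)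
    show "tensor_mult s\<^sub>H s\<^sub>K (X k) (Y (n - k)) \<in> tensor_space s\<^sub>H s\<^sub>K"
      unfolding U(2) V(2) tensor_mult_sum[OF H.mult_bilinear K.mult_bilinear]
      by (intro tensor_space_sum tensor_space_tensor)
  qed
next
  note vs = H.vector_space_axioms K.vector_space_axioms
  fix n i j c d assume c: "c \<in> K i" and d: "d \<in> H j"
  \<comment> \<open>The expansions are homogeneous because \<open>represents\<close> fixes values
    only at homogeneous arguments.\<close>
  obtain U :: "('f, 'b, 'b) tensors set" and x y ix iy
    where U: "finite U" "\<Delta>\<^sub>K c = (\<Sum>u\<in>U. tensor s\<^sub>K s\<^sub>K (x u) (y u))"
      "\<And>u. u \<in> U \<Longrightarrow> x u \<in> K (ix u)" "\<And>u. u \<in> U \<Longrightarrow> y u \<in> K (iy u)"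
      "\<And>u. u \<in> U \<Longrightarrow> ix u + iy u = i"
    using c by (rule K.comult_homogeneousE) blast
  obtain V :: "('f, 'a, 'a) tensors set" and z w iz iw
    where V: "finite V" "\<Delta>\<^sub>H d = (\<Sum>v\<in>V. tensor s\<^sub>H s\<^sub>H (z v) (w v))"
      "\<And>v. v \<in> V \<Longrightarrow> z v \<in> H (iz v)" "\<And>v. v \<in> V \<Longrightarrow> w v \<in> H (iw v)"
      "\<And>v. v \<in> V \<Longrightarrow> iz v + iw v = j"
    using d by (rule H.comult_homogeneousE) blast
  let ?W = "U \<times> V"
  have fW: "finite ?W" using U(1) V(1) by simp
  let ?B = "\<lambda>c d a b. p a c * p d b"
  have split: "p (a * a') c * p d (b * b') =
      (\<Sum>q\<in>?W. ?B (x (fst q)) (z (snd q)) a b * ?B (y (fst q)) (w (snd q)) a' b')" for a a' b b'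
    by (simp only: pairing_mult_left[OF U(2)] pairing_mult_right[OF V(2)] sum_product
        sum.cartesian_product) (simp add: split_def mult_ac)
  \<comment> \<open>\<open>X\<close> sees a pair of coproduct terms only when \<open>k\<close> is
    the total degree of their first factors; \<open>n - k\<close> is then the degree seen by
    \<open>Y\<close> exactly when \<open>n = i + j\<close>.\<close>
  have summand: "tensor_mult s\<^sub>H s\<^sub>K (X k) (Y (n - k)) (\<lambda>a b. p a c * p d b) =
      (\<Sum>q\<in>?W. if k = ix (fst q) + iz (snd q) then
        (if n = i + j then \<xi> (x (fst q)) (z (snd q)) * \<eta> (y (fst q)) (w (snd q)) else 0) else 0)"
    if k: "k \<le> n" for k
  proof -
    have "tensor_mult s\<^sub>H s\<^sub>K (X k) (Y (n - k)) (\<lambda>a b. p a c * p d b) =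
        X k (\<lambda>a b. Y (n - k) (\<lambda>a' b'. p (a * a') c * p d (b * b')))"
      by (simp only: tensor_mult_def pairing_product_bilinear(3) if_True)
    also have "\<dots> = X k (\<lambda>a b. \<Sum>q\<in>?W. ?B (x (fst q)) (z (snd q)) a b *
        Y (n - k) (?B (y (fst q)) (w (snd q))))"
      unfolding split
      by (subst tensor_space_apply_sum[OF vs representsD(1)[OF Y] fW pairing_product_bilinear(3)]) simp
    also have "\<dots> = X k (\<lambda>a b. \<Sum>q\<in>?W. Y (n - k) (?B (y (fst q)) (w (snd q))) *
        ?B (x (fst q)) (z (snd q)) a b)"
      by (simp only: mult.commute)
    also have "\<dots> = (\<Sum>q\<in>?W. Y (n - k) (?B (y (fst q)) (w (snd q))) * X k (?B (x (fst q)) (z (snd q))))"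
      by (rule tensor_space_apply_sum[OF vs representsD(1)[OF X] fW pairing_product_bilinear(3)])
    also have "\<dots> = (\<Sum>q\<in>?W. if k = ix (fst q) + iz (snd q) then
        (if n = i + j then \<xi> (x (fst q)) (z (snd q)) * \<eta> (y (fst q)) (w (snd q)) else 0) else 0)"
    proof (rule sum.cong)
      fix q assume "q \<in> ?W"
      then have q: "fst q \<in> U" "snd q \<in> V" by auto
      show "Y (n - k) (?B (y (fst q)) (w (snd q))) * X k (?B (x (fst q)) (z (snd q))) =
          (if k = ix (fst q) + iz (snd q) then
          (if n = i + j then \<xi> (x (fst q)) (z (snd q)) * \<eta> (y (fst q)) (w (snd q)) else 0) else 0)"
        using k U(5)[OF q(1)] V(5)[OF q(2)]
        by (auto simp: representsD(2)[OF X U(3)[OF q(1)] V(3)[OF q(2)]]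
            representsD(2)[OF Y U(4)[OF q(1)] V(4)[OF q(2)]])
    qed simp
    finally show ?thesis .
  qed
  have "completion_mult s\<^sub>H s\<^sub>K X Y n (\<lambda>a b. p a c * p d b) =
      (\<Sum>k\<le>n. \<Sum>q\<in>?W. if k = ix (fst q) + iz (snd q) then
        (if n = i + j then \<xi> (x (fst q)) (z (snd q)) * \<eta> (y (fst q)) (w (snd q)) else 0) else 0)"
    by (simp add: completion_mult_def sum_fun_apply summand)
  also have "\<dots> = (\<Sum>q\<in>?W. \<Sum>k\<le>n. if k = ix (fst q) + iz (snd q) then
        (if n = i + j then \<xi> (x (fst q)) (z (snd q)) * \<eta> (y (fst q)) (w (snd q)) else 0) else 0)"
    by (rule sum.swap)
  also have "\<dots> = (\<Sum>q\<in>?W. if n = i + j then \<xi> (x (fst q)) (z (snd q)) * \<eta> (y (fst q)) (w (snd q)) else 0)"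
  proof (rule sum.cong)
    fix q assume "q \<in> ?W"
    \<comment> \<open>For \<open>n = i + j\<close>, the one contributing \<open>k\<close> thus lies
      in the range of summation.\<close>
    then have "ix (fst q) + iz (snd q) \<le> i + j" using U(5)[of "fst q"] V(5)[of "snd q"] by force
    then show "(\<Sum>k\<le>n. if k = ix (fst q) + iz (snd q) then
        (if n = i + j then \<xi> (x (fst q)) (z (snd q)) * \<eta> (y (fst q)) (w (snd q)) else 0) else 0) =
        (if n = i + j then \<xi> (x (fst q)) (z (snd q)) * \<eta> (y (fst q)) (w (snd q)) else 0)"
      by (simp add: sum.delta)
  qed simp
  also have "\<dots> = (if n = i + j then \<zeta> c d else 0)"
    using val[OF c d U(2) V(2)] by (simp add: sum.cartesian_product split_def)
  finally show "completion_mult s\<^sub>H s\<^sub>K X Y n (\<lambda>a b. p a c * p d b) = (if n = i + j then \<zeta> c d else 0)" .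
qed

subsection \<open>The two identities\<close>

abbreviation "E \<equiv> completion_sum (\<lambda>l. T (f l) (g l))"

lemma degreewise_finite_canonical: "degreewise_finite (\<lambda>l. T (f l) (g l))"
  unfolding degreewise_finite_def
proof
  fix n
  have "\<exists>i\<le>n. f l \<in> H i" if nz: "T (f l) (g l) n \<noteq> 0" for l
  proof -
    obtain i c where c: "i \<le> n" "c \<in> K i" "p (f l) c \<noteq> 0"
      using nz by (rule completed_nonzeroE)
    obtain k where k: "f l \<in> H k" by (rule homogeneousE)
    with c pairing_orthogonal[OF k c(2)] show ?thesis by (intro exI[of _ i]) auto
  qed
  then show "finite {l. T (f l) (g l) n \<noteq> 0}"
    by (intro finite_subset[OF _ finite_bounded_degree[of n]]) blast
qed

lemma represents_canonical: "represents E (\<lambda>c d. p d c)"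
proof (rule represents_completion_sum[OF degreewise_finite_canonical represents_completed])
  fix c d
  show "\<exists>J. finite J \<and> {l. p (f l) c * p d (g l) \<noteq> 0} \<subseteq> J \<and>
      (\<Sum>l\<in>J. p (f l) c * p d (g l)) = p d c"
    by (intro exI[of _ "{l. p (f l) c \<noteq> 0}"] conjI pairing_expansion finite_support) auto
qed

text \<open>The first family has finite support already, since only finitely many
  \<open>fs l t\<close> are nonzero; the second is finite only in each degree.\<close>

lemma degreewise_finite_skew:
  "degreewise_finite (\<lambda>t. T (fs l t) (gs m t))" "degreewise_finite (\<lambda>r. T (fs r m) (gs r l))"
proof -
  show "degreewise_finite (\<lambda>t. T (fs l t) (gs m t))"
    unfolding degreewise_finite_def
  proof
    fix n
    have "{t. T (fs l t) (gs m t) n \<noteq> 0} \<subseteq> {t. fs l t \<noteq> 0}"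
      by (auto simp: completed_zero)
    then show "finite {t. T (fs l t) (gs m t) n \<noteq> 0}"
      using finite_support_skew(1) by (rule finite_subset)
  qed
  show "degreewise_finite (\<lambda>r. T (fs r m) (gs r l))"
    unfolding degreewise_finite_def by (intro allI finite_completed_skew)
qed

lemma represents_skew_left:
  "represents (completion_sum (\<lambda>t. T (fs l t) (gs m t)))
    (\<lambda>c d. \<Sum>t | fs l t \<noteq> 0. p (fs l t) c * p d (gs m t))"
proof (rule represents_completion_sum[OF degreewise_finite_skew(1) represents_completed])
  fix c d
  show "\<exists>J. finite J \<and> {t. p (fs l t) c * p d (gs m t) \<noteq> 0} \<subseteq> J \<and>
      (\<Sum>t\<in>J. p (fs l t) c * p d (gs m t)) =
      (\<Sum>t | fs l t \<noteq> 0. p (fs l t) c * p d (gs m t))"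
    by (intro exI[of _ "{t. fs l t \<noteq> 0}"] conjI finite_support_skew refl) auto
qed

text \<open>By the adjunctions, the \<open>r\<close>-th value is a term of the dual basis expansion
  of \<open>c * g m\<close> paired with \<open>d * f l\<close>.\<close>

lemma represents_skew_right:
  "represents (completion_sum (\<lambda>r. T (fs r m) (gs r l))) (\<lambda>c d. p (d * f l) (c * g m))"
proof (rule represents_completion_sum[OF degreewise_finite_skew(2) represents_completed])
  fix c d
  show "\<exists>J. finite J \<and> {r. p (fs r m) c * p d (gs r l) \<noteq> 0} \<subseteq> J \<and>
      (\<Sum>r\<in>J. p (fs r m) c * p d (gs r l)) = p (d * f l) (c * g m)"
    unfolding pairing_skew_left pairing_skew_right
    by (intro exI[of _ "{r. p (f r) (c * g m) \<noteq> 0}"] conjI pairing_expansion finite_support) auto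
qed

lemma canonical_mult_skew:
  "completion_mult s\<^sub>H s\<^sub>K E (completion_sum (\<lambda>t. T (fs l t) (gs m t))) =
    completion_sum (\<lambda>r. T (fs r m) (gs r l))"
proof (rule represents_unique[OF _ represents_skew_right],
    rule represents_completion_mult[OF represents_canonical represents_skew_left])
  fix c d x y z w and U :: "('f, 'b, 'b) tensors set" and V :: "('f, 'a, 'a) tensors set"
  assume U: "\<Delta>\<^sub>K c = (\<Sum>u\<in>U. tensor s\<^sub>K s\<^sub>K (x u) (y u))"
    and V: "\<Delta>\<^sub>H d = (\<Sum>v\<in>V. tensor s\<^sub>H s\<^sub>H (z v) (w v))"
  let ?L = "{t. fs l t \<noteq> 0}"
  \<comment> \<open>Summing over \<open>v\<close> reassembles the coproduct of \<open>d\<close> into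
    pairings of \<open>d\<close> with \<open>x u * gs m t\<close>, as they occur in
    \<open>pairing_skew_mult\<close>.\<close>
  have "(\<Sum>v\<in>V. p (z v) (x u) * (\<Sum>t\<in>?L. p (fs l t) (y u) * p (w v) (gs m t))) =
      (\<Sum>t\<in>?L. p d (x u * gs m t) * p (fs l t) (y u))" for u
  proof -
    have "(\<Sum>v\<in>V. p (z v) (x u) * (\<Sum>t\<in>?L. p (fs l t) (y u) * p (w v) (gs m t))) =
        (\<Sum>v\<in>V. \<Sum>t\<in>?L. p (z v) (x u) * p (w v) (gs m t) * p (fs l t) (y u))"
      by (simp add: sum_distrib_left mult_ac)
    also have "\<dots> = (\<Sum>t\<in>?L. \<Sum>v\<in>V. p (z v) (x u) * p (w v) (gs m t) * p (fs l t) (y u))"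
      by (rule sum.swap)
    finally show ?thesis by (simp add: pairing_mult_right[OF V] sum_distrib_right)
  qed
  then show "(\<Sum>u\<in>U. \<Sum>v\<in>V. p (z v) (x u) * (\<Sum>t\<in>?L. p (fs l t) (y u) * p (w v) (gs m t))) =
      p (d * f l) (c * g m)"
    by (simp add: pairing_skew_mult[OF U])
qed

section \<open>The second identity\<close>

text \<open>Since \<open>S\<^sub>K 0 = 0\<close>, only the finitely many \<open>m\<close> with
  \<open>gs e m\<close> nonzero occur, and for each of them the degree bound leaves finitely many
  \<open>r\<close>.\<close>

lemma degreewise_finite_antipode:
  "degreewise_finite (\<lambda>(r, m). T (fs r m) (S\<^sub>K (gs e m) * gs r l))"
  unfolding degreewise_finite_def
proof
  fix n
  have "{rm. (case rm of (r, m) \<Rightarrow> T (fs r m) (S\<^sub>K (gs e m) * gs r l)) n \<noteq> 0} \<subseteq>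
      (\<Union>m\<in>{m. gs e m \<noteq> 0}. (\<lambda>r. (r, m)) ` {r. T (fs r m) (S\<^sub>K (gs e m) * gs r l) n \<noteq> 0})"
  proof clarsimp
    fix r m assume nz: "T (fs r m) (S\<^sub>K (gs e m) * gs r l) n \<noteq> 0"
    have "gs e m \<noteq> 0"
    proof
      assume "gs e m = 0"
      with nz show False by (simp add: K.antipode_zero completed_zero)
    qed
    with nz show "\<exists>m'. gs e m' \<noteq> 0 \<and>
        (r, m) \<in> (\<lambda>r. (r, m')) ` {r. T (fs r m') (S\<^sub>K (gs e m') * gs r l) n \<noteq> 0}" by blast
  qed
  then show "finite {rm. (case rm of (r, m) \<Rightarrow> T (fs r m) (S\<^sub>K (gs e m) * gs r l)) n \<noteq> 0}"
    by (rule finite_subset) (intro finite_UN_I finite_support_skew finite_imageI finite_completed_skew)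
qed

text \<open>The second identity evaluated at fixed \<open>c\<close> and \<open>d\<close>. The set
  \<open>J\<close> contains the relevant \<open>r\<close> for every \<open>m\<close> at once, so the
  double sum is finite and can be reordered.\<close>

lemma antipode_pairing_sum:
  assumes comm: "\<And>x y :: 'b. x * y = y * x"
    and U: "\<Delta>\<^sub>K c = (\<Sum>u\<in>U. tensor s\<^sub>K s\<^sub>K (x u) (y u))"
    and J: "finite J" "\<And>m. gs e m \<noteq> 0 \<Longrightarrow> {r. p (f r) (c * g m) \<noteq> 0} \<subseteq> J"
  shows "(\<Sum>m | gs e m \<noteq> 0. \<Sum>r\<in>J. p (fs r m) c * p d (S\<^sub>K (gs e m) * gs r l)) =
    (\<Sum>u\<in>U. p (fs l e) (y u) * p d (x u))"
proof -
  let ?M = "{m. gs e m \<noteq> 0}" and ?L = "{t. fs l t \<noteq> 0}"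
  obtain V :: "('f, 'a, 'a) tensors set" and z w
    where V: "\<Delta>\<^sub>H d = (\<Sum>v\<in>V. tensor s\<^sub>H s\<^sub>H (z v) (w v))"
    using H.vector_space_axioms H.vector_space_axioms H.comult_tensor[of d] by (rule tensor_spaceE)
  \<comment> \<open>The first identity multiplied by 1 tensor \<open>q\<close>: splitting the
    coproduct of \<open>d\<close> detaches \<open>q\<close>, the dual basis sum over
    \<open>r\<close> is carried out, and \<open>d\<close> is reassembled.\<close>
  have inner: "(\<Sum>r\<in>J. p (fs r m) c * p d (q * gs r l)) =
      (\<Sum>u\<in>U. \<Sum>t\<in>?L. p (fs l t) (y u) * p d (q * (x u * gs m t)))" if m: "gs e m \<noteq> 0" for m q
  proof -
    have "(\<Sum>r\<in>J. p (fs r m) c * p d (q * gs r l)) =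
        (\<Sum>r\<in>J. \<Sum>v\<in>V. p (z v) q * (p (f r) (c * g m) * p (w v * f l) (g r)))"
      by (simp add: pairing_mult_right[OF V] pairing_skew_left pairing_skew_right sum_distrib_left mult_ac)
    also have "\<dots> = (\<Sum>v\<in>V. \<Sum>r\<in>J. p (z v) q * (p (f r) (c * g m) * p (w v * f l) (g r)))"
      by (rule sum.swap)
    also have "\<dots> = (\<Sum>v\<in>V. p (z v) q * p (w v * f l) (c * g m))"
      by (simp add: pairing_expansion[OF J(1) J(2)[OF m]] flip: sum_distrib_left)
    also have "\<dots> = (\<Sum>v\<in>V. \<Sum>u\<in>U. \<Sum>t\<in>?L. p (fs l t) (y u) * (p (z v) q * p (w v) (x u * gs m t)))"
      by (simp add: pairing_skew_mult[OF U] sum_distrib_left mult_ac)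
    also have "\<dots> = (\<Sum>u\<in>U. \<Sum>v\<in>V. \<Sum>t\<in>?L. p (fs l t) (y u) * (p (z v) q * p (w v) (x u * gs m t)))"
      by (rule sum.swap)
    also have "\<dots> = (\<Sum>u\<in>U. \<Sum>t\<in>?L. \<Sum>v\<in>V. p (fs l t) (y u) * (p (z v) q * p (w v) (x u * gs m t)))"
      by (intro sum.cong refl sum.swap)
    finally show ?thesis by (simp add: pairing_mult_right[OF V] sum_distrib_left)
  qed
  have collapse: "(\<Sum>m\<in>?M. p d (S\<^sub>K (gs e m) * (x u * gs m t))) = (if t = e then p d (x u) else 0)" for u t
  proof -
    \<comment> \<open>Commutativity moves \<open>S\<^sub>K (gs e m)\<close> past \<open>x u\<close>,
      next to \<open>gs m t\<close>, where \<open>skew_antipode\<close> applies.\<close>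
    have "q * (x u * q') = x u * (q * q')" for q q'
      using comm[of q "x u"] by (simp flip: mult.assoc)
    then have "(\<Sum>m\<in>?M. p d (S\<^sub>K (gs e m) * (x u * gs m t))) = p d (x u * (\<Sum>m\<in>?M. S\<^sub>K (gs e m) * gs m t))"
      by (simp add: sum_distrib_left pairing_sum)
    also have "(\<Sum>m\<in>?M. S\<^sub>K (gs e m) * gs m t) = (if e = t then 1 else 0)"
      by (rule K.skew_antipode[OF bases(2), of "\<lambda>t. p (f t)"]) (simp_all add: pairing_linear)
    finally show ?thesis by auto
  qed
  have "(\<Sum>m\<in>?M. \<Sum>r\<in>J. p (fs r m) c * p d (S\<^sub>K (gs e m) * gs r l)) =
      (\<Sum>m\<in>?M. \<Sum>u\<in>U. \<Sum>t\<in>?L. p (fs l t) (y u) * p d (S\<^sub>K (gs e m) * (x u * gs m t)))"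
    by (rule sum.cong) (auto simp: inner)
  also have "\<dots> = (\<Sum>u\<in>U. \<Sum>m\<in>?M. \<Sum>t\<in>?L. p (fs l t) (y u) * p d (S\<^sub>K (gs e m) * (x u * gs m t)))"
    by (rule sum.swap)
  also have "\<dots> = (\<Sum>u\<in>U. \<Sum>t\<in>?L. \<Sum>m\<in>?M. p (fs l t) (y u) * p d (S\<^sub>K (gs e m) * (x u * gs m t)))"
    by (intro sum.cong refl sum.swap)
  also have "\<dots> = (\<Sum>u\<in>U. \<Sum>t\<in>?L. if t = e then p (fs l t) (y u) * p d (x u) else 0)"
    by (simp add: collapse flip: sum_distrib_left) (intro sum.cong refl; simp)
  \<comment> \<open>If \<open>e\<close> is outside \<open>?L\<close>, then \<open>fs l e = 0\<close>
    and both sides are 0.\<close>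
  also have "\<dots> = (\<Sum>u\<in>U. p (fs l e) (y u) * p d (x u))"
    using finite_support_skew(1) by (intro sum.cong refl) (auto simp: sum.delta)
  finally show ?thesis .
qed

lemma canonical_mult_antipode:
  assumes comm: "\<And>x y :: 'b. x * y = y * x"
  shows "completion_mult s\<^sub>H s\<^sub>K E (T (fs l e) 1) =
    completion_sum (\<lambda>(r, m). T (fs r m) (S\<^sub>K (gs e m) * gs r l))"
proof -
  \<comment> \<open>The common form of both sides is an evaluation of the tensor
    \<open>\<Delta>\<^sub>K c\<close> itself, hence independent of the expansions over which
    \<open>represents_completion_mult\<close> ranges.\<close>
  define \<zeta> where "\<zeta> c d = \<Delta>\<^sub>K c (\<lambda>x y. p (fs l e) y * p d x)" for c d
  have bil: "bilinear_map s\<^sub>K s\<^sub>K (*) (\<lambda>x y. p (fs l e) y * p d x)" for d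
    by (rule bilinear_formI[OF K.vector_space_axioms K.vector_space_axioms]) (simp_all add: algebra_simps)
  have "represents (completion_mult s\<^sub>H s\<^sub>K E (T (fs l e) 1)) \<zeta>"
  proof (rule represents_completion_mult[OF represents_canonical represents_completed])
    fix c d x y z w and U :: "('f, 'b, 'b) tensors set" and V :: "('f, 'a, 'a) tensors set"
    assume U: "\<Delta>\<^sub>K c = (\<Sum>u\<in>U. tensor s\<^sub>K s\<^sub>K (x u) (y u))"
      and V: "\<Delta>\<^sub>H d = (\<Sum>v\<in>V. tensor s\<^sub>H s\<^sub>H (z v) (w v))"
    have "(\<Sum>v\<in>V. p (z v) (x u) * (p (fs l e) (y u) * p (w v) 1)) = p (fs l e) (y u) * p d (x u)" for u
      using pairing_mult_right[OF V, of "x u" 1] by (simp add: sum_distrib_left mult_ac)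
    then show "(\<Sum>u\<in>U. \<Sum>v\<in>V. p (z v) (x u) * (p (fs l e) (y u) * p (w v) 1)) = \<zeta> c d"
      by (simp add: \<zeta>_def U sum_tensor_apply[OF bil])
  qed
  moreover have "represents (completion_sum (\<lambda>(r, m). T (fs r m) (S\<^sub>K (gs e m) * gs r l))) \<zeta>"
  proof (rule represents_completion_sum[OF degreewise_finite_antipode])
    show "represents (case rm of (r, m) \<Rightarrow> T (fs r m) (S\<^sub>K (gs e m) * gs r l))
        (case rm of (r, m) \<Rightarrow> \<lambda>c d. p (fs r m) c * p d (S\<^sub>K (gs e m) * gs r l))" for rm
      by (cases rm) (simp add: represents_completed)
  next
    fix c d
    obtain U :: "('f, 'b, 'b) tensors set" and x y
      where U: "\<Delta>\<^sub>K c = (\<Sum>u\<in>U. tensor s\<^sub>K s\<^sub>K (x u) (y u))"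
      using K.vector_space_axioms K.vector_space_axioms K.comult_tensor[of c] by (rule tensor_spaceE)
    let ?M = "{m. gs e m \<noteq> 0}"
    \<comment> \<open>\<open>p (fs r m) c\<close> equals \<open>p (f r) (c * g m)\<close>, so
      \<open>?J \<times> ?M\<close> contains every pair with a nonzero value.\<close>
    let ?J = "\<Union>m\<in>?M. {r. p (f r) (c * g m) \<noteq> 0}"
    have J: "finite ?J" using finite_support_skew(2) finite_support(2) by blast
    have "(\<Sum>rm\<in>?J \<times> ?M. (case rm of (r, m) \<Rightarrow> \<lambda>c d. p (fs r m) c * p d (S\<^sub>K (gs e m) * gs r l)) c d) =
        (\<Sum>r\<in>?J. \<Sum>m\<in>?M. p (fs r m) c * p d (S\<^sub>K (gs e m) * gs r l))"
      by (simp add: sum.cartesian_product split_def)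
    also have "\<dots> = (\<Sum>m\<in>?M. \<Sum>r\<in>?J. p (fs r m) c * p d (S\<^sub>K (gs e m) * gs r l))"
      by (rule sum.swap)
    also have "\<dots> = (\<Sum>u\<in>U. p (fs l e) (y u) * p d (x u))"
      by (rule antipode_pairing_sum[OF comm U J]) auto
    also have "\<dots> = \<zeta> c d" by (simp add: \<zeta>_def U sum_tensor_apply[OF bil])
    finally have "(\<Sum>rm\<in>?J \<times> ?M. (case rm of (r, m) \<Rightarrow> \<lambda>c d. p (fs r m) c * p d (S\<^sub>K (gs e m) * gs r l)) c d)
        = \<zeta> c d" .
    moreover have "{rm. (case rm of (r, m) \<Rightarrow> \<lambda>c d. p (fs r m) c * p d (S\<^sub>K (gs e m) * gs r l)) c d \<noteq> 0}
        \<subseteq> ?J \<times> ?M"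
    proof clarify
      fix r m assume nz: "p (fs r m) c * p d (S\<^sub>K (gs e m) * gs r l) \<noteq> 0"
      have "gs e m \<noteq> 0"
      proof
        assume "gs e m = 0"
        with nz show False by (simp add: K.antipode_zero)
      qed
      with nz show "r \<in> ?J \<and> m \<in> ?M" by (auto simp: pairing_skew_left)
    qed
    ultimately show "\<exists>J. finite J \<and>
        {rm. (case rm of (r, m) \<Rightarrow> \<lambda>c d. p (fs r m) c * p d (S\<^sub>K (gs e m) * gs r l)) c d \<noteq> 0} \<subseteq> J \<and>
        (\<Sum>rm\<in>J. (case rm of (r, m) \<Rightarrow> \<lambda>c d. p (fs r m) c * p d (S\<^sub>K (gs e m) * gs r l)) c d) = \<zeta> c d"
      using J finite_support_skew(2) by (intro exI[of _ "?J \<times> ?M"]) simp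
  qed
  ultimately show ?thesis by (rule represents_unique)
qed

end

text \<open>The finiteness clauses belong to the claim because \<open>completion_sum\<close> is
  meaningful only for \<open>degreewise_finite\<close> families. \<open>K\<close> is H^vee, and the
  sum over two indices is a sum over pairs.\<close>

theorem theorem1:
  fixes s\<^sub>H :: "'f::field \<Rightarrow> 'a::ring_1 \<Rightarrow> 'a"
    and H :: "nat \<Rightarrow> 'a set"
    and \<Delta>\<^sub>H :: "'a \<Rightarrow> ('f, 'a, 'a) tensors"
    and \<epsilon>\<^sub>H :: "'a \<Rightarrow> 'f"
    and S\<^sub>H :: "'a \<Rightarrow> 'a"
    and s\<^sub>K :: "'f \<Rightarrow> 'b::ring_1 \<Rightarrow> 'b"
    and K :: "nat \<Rightarrow> 'b set"
    and \<Delta>\<^sub>K :: "'b \<Rightarrow> ('f, 'b, 'b) tensors"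
    and \<epsilon>\<^sub>K :: "'b \<Rightarrow> 'f"
    and S\<^sub>K :: "'b \<Rightarrow> 'b"
    and p :: "'a \<Rightarrow> 'b \<Rightarrow> 'f"
    and f :: "'i \<Rightarrow> 'a"
    and g :: "'i \<Rightarrow> 'b"
    and fs :: "'i \<Rightarrow> 'i \<Rightarrow> 'a"
    and gs :: "'i \<Rightarrow> 'i \<Rightarrow> 'b"
    and T :: "'a \<Rightarrow> 'b \<Rightarrow> ('f, 'a, 'b) completion"
    and E :: "('f, 'a, 'b) completion"
  assumes "graded_connected_hopf_algebra s\<^sub>H H \<Delta>\<^sub>H \<epsilon>\<^sub>H S\<^sub>H"
    and "graded_connected_hopf_algebra s\<^sub>K K \<Delta>\<^sub>K \<epsilon>\<^sub>K S\<^sub>K"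
    and "finite_dimensional_pieces s\<^sub>H H"
    and "finite_dimensional_pieces s\<^sub>K K"
    and "graded_nondegenerate_hopf_pairing s\<^sub>H H \<Delta>\<^sub>H s\<^sub>K K \<Delta>\<^sub>K p"
    and "homogeneous_dual_bases s\<^sub>H H s\<^sub>K K p f g"
    and "fs = skew s\<^sub>H \<Delta>\<^sub>H f"
    and "gs = skew s\<^sub>K \<Delta>\<^sub>K g"
    and "T = (\<lambda>a b. completed s\<^sub>H H s\<^sub>K K (tensor s\<^sub>H s\<^sub>K a b))"
    and "E = completion_sum (\<lambda>l. T (f l) (g l))"
  shows "degreewise_finite (\<lambda>l. T (f l) (g l)) \<and>
    (\<forall>l m.
       degreewise_finite (\<lambda>t. T (fs l t) (gs m t)) \<and>
       degreewise_finite (\<lambda>r. T (fs r m) (gs r l)) \<and>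
       completion_mult s\<^sub>H s\<^sub>K E (completion_sum (\<lambda>t. T (fs l t) (gs m t))) =
       completion_sum (\<lambda>r. T (fs r m) (gs r l))) \<and>
    ((\<forall>x y :: 'b. x * y = y * x) \<longrightarrow>
     (\<forall>l e.
       degreewise_finite (\<lambda>(r, m). T (fs r m) (S\<^sub>K (gs e m) * gs r l)) \<and>
       completion_mult s\<^sub>H s\<^sub>K E (T (fs l e) 1) =
       completion_sum (\<lambda>(r, m). T (fs r m) (S\<^sub>K (gs e m) * gs r l))))"
proof -
  interpret D: dual_hopf_pair s\<^sub>H H \<Delta>\<^sub>H \<epsilon>\<^sub>H S\<^sub>H s\<^sub>K K \<Delta>\<^sub>K \<epsilon>\<^sub>K S\<^sub>K p f g
    using assms(1-3,5,6) by (intro dual_hopf_pair.intro dual_hopf_pair_axioms.intro)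
  show ?thesis
    unfolding assms(10) unfolding assms(7-9)
    by (intro conjI allI impI D.degreewise_finite_canonical D.degreewise_finite_skew
        D.degreewise_finite_antipode D.canonical_mult_skew D.canonical_mult_antipode) blast
qed

end
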